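(* Let $q>1$. Among sequences $m=(m(n))_{n\ge0}$ of positive real numbers with $m(0)=1$, the set of sequences preserving $q$-Gevrey asymptotic expansions is strictly contained in the set of sequences preserving summability; that is, every sequence preserving $q$-Gevrey asymptotic expansions preserves summability, and there exists a sequence preserving summability that does not preserve $q$-Gevrey asymptotic expansions.
   Context: Let $\mathbb{E}\neq\{0\}$ be a complex Banach space with norm $\|\cdot\|_{\mathbb{E}}$, $\mathbb{E}[[t]]$ the space of formal power series with coefficients in $\mathbb{E}$, and $\mathbb{E}\{t\}$ the space of convergent ones. For a sequence $m$ of positive numbers, $\mathcal{B}_m(\sum_{n\ge0} a_nt^n)=\sum_{n\ge0}\frac{a_n}{m(n)}t^n$. Summability. For $d\in\mathbb{R}$ and $\alpha,r>0$ put $S_d(\alpha)=\{\rho e^{i\phi}:\rho>0,\ \phi\in(d-\alpha/2,d+\alpha/2)\}$, $D_r=\{z\in\mathbb{C}:|z|<r\}$, and $\hat S_d(\alpha,r)=S_d(\alpha)\cup D_r$ (a disc-sector in direction $d$, written $\hat S_d$ when $\alpha,r$ are not essential). For $k>0$, $\mathcal{O}^k(\hat S_d(\alpha,r),\mathbb{E})$ is the set of holomorphic $f:\hat S_d(\alpha,r)\to\mathbb{E}$ such that for all $\tilde\alpha\in(0,\alpha)$, $\tilde r\in(0,r)$ there are $A,B>0$ with $\|f(t)\|_{\mathbb{E}}<Ae^{B|t|^k}$ for all $t\in\hat S_d(\tilde\alpha,\tilde r)$. For a power series, membership means that it converges near $0$ and its sum extends analytically to such a function. Put $\Gamma_{1/k}=(\Gamma(1+n/k))_{n\ge0}$.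 A series $\hat u\in\mathbb{E}[[t]]$ is $k$-summable in direction $d$ ($\hat u\in\mathbb{E}\{t\}_{k,d}$) if there is a disc-sector $\hat S_d$ with $\mathcal{B}_{\Gamma_{1/k}}\hat u\in\mathcal{O}^k(\hat S_d,\mathbb{E})$. A sequence $m$ preserves summability if for every $k>0$, $d\in\mathbb{R}$ and $\hat u\in\mathbb{E}[[t]]$: $\hat u\in\mathbb{E}\{t\}_{k,d}$ if and only if $\mathcal{B}_m\hat u\in\mathbb{E}\{t\}_{k,d}$. $q$-Gevrey. For $s>0$, $\mathcal{B}_{q;s}(\sum_{n\ge0} a_nt^n)=\sum_{n\ge0}\frac{a_n}{q^{s n(n-1)/2}}t^n$. A holomorphic $\mathbb{E}$-valued function $f$ is of $q$-exponential growth of order $1/s$ on an unbounded sector if there exist $C,h>0$ and $\alpha\in\mathbb{R}$ with $\|f(t)\|_{\mathbb{E}}\le C\exp\big(\frac{\log^2(|t|+h)}{2s\log q}\big)(|t|+h)^{\alpha}$ for all $t$ in the sector. A sequence $m$ preserves $q$-Gevrey asymptotic expansions if for every $s>0$, $d\in\mathbb{R}$ and $\hat u\in\mathbb{E}[[t]]$ the following are equivalent: (i) $\mathcal{B}_{q;s}(\hat u)\in\mathbb{E}\{t\}$ and its sum extends analytically to an infinite sector (vertex $0$, positive opening) with bisecting direction $d$, with $q$-exponential growth of order $1/s$ on that sector; (ii) $\mathcal{B}_{q;s}\mathcal{B}_m(\hat u)\in\mathbb{E}\{t\}$ and its sum extends analytically to an infinite sector with bisecting direction $d$, with $q$-exponential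 growth of order $1/s$ on that sector. *)

theory Defs
  imports "HOL-Analysis.Analysis"
begin

class complex_banach = banach +
  fixes scaleC :: "complex \<Rightarrow> 'a \<Rightarrow> 'a"  (infixr "*\<^sub>C" 75)
  assumes scaleC_add_right: "c *\<^sub>C (x + y) = c *\<^sub>C x + c *\<^sub>C y"
    and scaleC_add_left: "(b + c) *\<^sub>C x = b *\<^sub>C x + c *\<^sub>C x"
    and scaleC_scaleC: "b *\<^sub>C c *\<^sub>C x = (b * c) *\<^sub>C x"
    and scaleC_of_real: "complex_of_real r *\<^sub>C x = r *\<^sub>R x"
    and norm_scaleC: "norm (c *\<^sub>C x) = cmod c * norm x"

text \<open>The class is inhabited by the complex numbers themselves.\<close>

instantiation complex :: complex_banach
begin

definition scaleC_complex :: "complex \<Rightarrow> complex \<Rightarrow> complex" where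
  "scaleC_complex c x = c * x"

instance
  by standard (simp_all add: scaleC_complex_def algebra_simps norm_mult scaleR_conv_of_real)

end

text \<open>The library's \<open>holomorphic_on\<close> only covers field-valued functions.  As there, the derivative
  is taken within the set; all sets used below are open.\<close>

definition vholomorphic_on :: "(complex \<Rightarrow> 'e::complex_banach) \<Rightarrow> complex set \<Rightarrow> bool"
    (infix "vholomorphic'_on" 50) where
  "f vholomorphic_on S \<longleftrightarrow>
     (\<forall>z\<in>S. \<exists>D. (f has_derivative (\<lambda>h. h *\<^sub>C D)) (at z within S))"

definition sector :: "real \<Rightarrow> real \<Rightarrow> complex set" where
  "sector d \<alpha> = {complex_of_real \<rho> * cis \<phi> | \<rho> \<phi>. \<rho> > 0 \<and> \<phi> \<in> {d - \<alpha>/2 <..< d + \<alpha>/2}}"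

definition disc_sector :: "real \<Rightarrow> real \<Rightarrow> real \<Rightarrow> complex set" where
  "disc_sector d \<alpha> r = sector d \<alpha> \<union> ball 0 r"

text \<open>The series converges near \<open>0\<close>, with sum \<open>f\<close> there.\<close>

definition has_sum_near_0 :: "'e::complex_banach fps \<Rightarrow> (complex \<Rightarrow> 'e) \<Rightarrow> bool" where
  "has_sum_near_0 u f \<longleftrightarrow> (\<exists>\<rho>>0. \<forall>t\<in>ball 0 \<rho>. (\<lambda>n. t ^ n *\<^sub>C fps_nth u n) sums f t)"

definition borel_map :: "(nat \<Rightarrow> real) \<Rightarrow> 'e::complex_banach fps \<Rightarrow> 'e fps" where
  "borel_map m u = Abs_fps (\<lambda>n. fps_nth u n /\<^sub>R m n)"

definition exp_growth_functions ::
    "real \<Rightarrow> real \<Rightarrow> real \<Rightarrow> real \<Rightarrow> (complex \<Rightarrow> 'e::complex_banach) set" where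
  "exp_growth_functions k d \<alpha> r =
     {f. f vholomorphic_on disc_sector d \<alpha> r \<and>
         (\<forall>\<alpha>'\<in>{0<..<\<alpha>}. \<forall>r'\<in>{0<..<r}. \<exists>A>0. \<exists>B>0. \<forall>t\<in>disc_sector d \<alpha>' r'.
            norm (f t) < A * exp (B * cmod t powr k))}"

definition summable_in_direction :: "real \<Rightarrow> real \<Rightarrow> 'e::complex_banach fps \<Rightarrow> bool" where
  "summable_in_direction k d u \<longleftrightarrow>
     (\<exists>\<alpha>>0. \<exists>r>0. \<exists>f\<in>exp_growth_functions k d \<alpha> r.
        has_sum_near_0 (borel_map (\<lambda>n. Gamma (1 + real n / k)) u) f)"

text \<open>The coefficient space is passed as a type argument: both preservation properties refer to it,
  but the sequence does not determine it.\<close>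

definition preserves_summability :: "'e::complex_banach itself \<Rightarrow> (nat \<Rightarrow> real) \<Rightarrow> bool" where
  "preserves_summability _ m \<longleftrightarrow>
     (\<forall>k>0. \<forall>d. \<forall>u :: 'e fps.
        summable_in_direction k d u \<longleftrightarrow> summable_in_direction k d (borel_map m u))"

definition q_borel_map :: "real \<Rightarrow> real \<Rightarrow> 'e::complex_banach fps \<Rightarrow> 'e fps" where
  "q_borel_map q s = borel_map (\<lambda>n. q powr (s * real n * (real n - 1) / 2))"

definition q_exp_growth ::
    "real \<Rightarrow> real \<Rightarrow> (complex \<Rightarrow> 'e::complex_banach) \<Rightarrow> complex set \<Rightarrow> bool" where
  "q_exp_growth q s f S \<longleftrightarrow>
     (\<exists>C>0. \<exists>h>0. \<exists>\<alpha>. \<forall>t\<in>S.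
        norm (f t) \<le> C * exp ((ln (cmod t + h))\<^sup>2 / (2 * s * ln q)) * (cmod t + h) powr \<alpha>)"

text \<open>Extending the sum of a convergent series to a sector means extending it to the union of the
  sector with some disc about \<open>0\<close>; the growth bound is imposed on the sector only.\<close>

definition q_extends_in_direction ::
    "real \<Rightarrow> real \<Rightarrow> real \<Rightarrow> 'e::complex_banach fps \<Rightarrow> bool" where
  "q_extends_in_direction q s d v \<longleftrightarrow>
     (\<exists>\<alpha>>0. \<exists>r>0. \<exists>f. f vholomorphic_on disc_sector d \<alpha> r \<and>
        has_sum_near_0 v f \<and> q_exp_growth q s f (sector d \<alpha>))"

definition preserves_q_Gevrey ::
    "'e::complex_banach itself \<Rightarrow> real \<Rightarrow> (nat \<Rightarrow> real) \<Rightarrow> bool" where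
  "preserves_q_Gevrey _ q m \<longleftrightarrow>
     (\<forall>s>0. \<forall>d. \<forall>u :: 'e fps.
        q_extends_in_direction q s d (q_borel_map q s u) \<longleftrightarrow>
        q_extends_in_direction q s d (q_borel_map q s (borel_map m u)))"

definition admissible_sequences :: "(nat \<Rightarrow> real) set" where
  "admissible_sequences = {m. (\<forall>n. m n > 0) \<and> m 0 = 1}"

end

theory Submission
  imports Defs "HOL-Complex_Analysis.Complex_Analysis" "HOL-Real_Asymp.Real_Asymp"
begin

text \<open>
  Both properties concern the coefficientwise multiplication of convergent series by \<open>1 / m n\<close>
  and \<open>m n\<close>.  If \<open>m\<close> preserves \<open>q\<close>-Gevrey expansions, then testing it on the geometric
  series \<open>1 / (1 - t)\<close> shows that \<open>g(t) = \<Sum>\<^sub>n t\<^sup>n / m n\<close> extends to all directions other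
  than the positive real axis, with growth below every \<open>exp (\<bar>t\<bar>\<^sup>k)\<close>; the same holds for
  \<open>\<Sum>\<^sub>n m n t\<^sup>n\<close>.  Multiplying the coefficients of \<open>f\<close> by \<open>1 / m n\<close> is the integral
  \<open>(1 / 2\<pi>\<i>) \<integral> g(w) f(t / w) dw / w\<close> over a circle.  Away from the positive axis the circle can
  be pushed out to a radius comparable to \<open>\<bar>t\<bar>\<close>, so that \<open>t / w\<close> stays in the disc-sector of \<open>f\<close>;
  this yields the extension and its exponential growth.

  The inclusion is strict because of \<open>1 / m n = 1 + (-1)\<^sup>n exp (- n\<^sup>3\<^sup>/\<^sup>2)\<close> for \<open>n > 0\<close>: this
  changes the sum of a convergent series only by an entire function of exponential order \<open>0\<close>, but for
  the geometric series this entire function grows like \<open>exp (c log\<^sup>3 \<bar>t\<bar>)\<close> on the negative axis.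

  Vector-valued functions are reduced to scalar ones by continuous linear functionals.
\<close>

section \<open>Norming functionals\<close>

text \<open>The q-Borel weights are nonzero, so \<open>q_borel_map\<close> is a bijection of formal
  series and preservation concerns arbitrary coefficient sequences; it is tested only for
  \<open>s = 1\<close> on the sequences \<open>x\<close> and \<open>m n *\<^sub>R x\<close>. The
  Gamma weights of k-summability commute with multiplication of coefficients. The obstacle is that
  each direction yields a sector whose opening is not controlled, and the positive axis yields none,
  so the kernel is not bounded along a whole large circle. Hence the contour returns to a small
  radius inside the disc of convergence to cross the axis. There t / w may be large, but its
  argument is close to that of t, so shrinking the opening of the sector suffices. The exponent p =
  3/2 lies strictly between 1 and 2: above 1, exp (- n^p) beats all factorials and gives order 0;
  below 2, the largest term at modulus exp L has logarithm of order L^(p/(p-1)) with p/(p-1) > 2,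
  beyond the squared logarithm that q-exponential growth permits.\<close>

definition sublinear :: "('a::real_vector \<Rightarrow> real) \<Rightarrow> bool" where
  "sublinear p \<longleftrightarrow> (\<forall>x y. p (x + y) \<le> p x + p y) \<and> (\<forall>x. \<forall>c\<ge>0. p (c *\<^sub>R x) \<le> c * p x)"

lemma sublinear_add: "sublinear p \<Longrightarrow> p (x + y) \<le> p x + p y"
  and sublinear_scale_le: "sublinear p \<Longrightarrow> 0 \<le> c \<Longrightarrow> p (c *\<^sub>R x) \<le> c * p x"
  by (auto simp: sublinear_def)

lemma sublinear_zero: "sublinear p \<Longrightarrow> p 0 = 0"
  using sublinear_add[of p 0 0] sublinear_scale_le[of p 0 0] by simp

text \<open>Only \<open>\<le>\<close> is demanded in \<open>sublinear\<close>, since infima inherit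
  it easily; the reverse inequality follows by scaling back with \<open>inverse c\<close>.\<close>

lemma sublinear_scale:
  assumes "sublinear p" "0 \<le> c" shows "p (c *\<^sub>R x) = c * p x"
proof (cases "c = 0")
  case False
  with assms have "p x \<le> inverse c * p (c *\<^sub>R x)"
    using sublinear_scale_le[of p "inverse c" "c *\<^sub>R x"] by simp
  with False assms have "c * p x \<le> p (c *\<^sub>R x)" by (simp add: field_simps)
  with sublinear_scale_le[OF assms] show ?thesis by (simp add: antisym)
qed (simp add: sublinear_zero assms)

lemma sublinear_ge_minus: "sublinear p \<Longrightarrow> - p (- x) \<le> p x"
  using sublinear_add[of p x "- x"] sublinear_zero[of p] by simp

text \<open>The Hahn-Banach functional: the infimum over t >= 0 of p (y + t x) - t p x. It lies
  below p, so a minimal p coincides with it; the last bound then reads p y + p x <= p (y + x), the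
  missing half of additivity.\<close>

lemma sublinear_descend:
  fixes p :: "'a::real_vector \<Rightarrow> real"
  assumes p: "sublinear p"
  obtains p' where "sublinear p'" "p' \<le> p" "\<And>y. p' y \<le> p (y + x) - p x"
proof
  define h where "h y t = p (y + t *\<^sub>R x) - t * p x" for y t
  define p' where "p' y = (INF t\<in>{0..}. h y t)" for y
  \<comment> \<open>A real infimum is meaningful only over a set bounded below; subadditivity
    supplies the bound - p (- y), uniformly in t.\<close>
  have lb: "- p (- y) \<le> h y t" if "t \<ge> 0" for y t
  proof -
    have "t * p x = p ((y + t *\<^sub>R x) + - y)" using sublinear_scale[OF p that] by simp
    also have "\<dots> \<le> p (y + t *\<^sub>R x) + p (- y)" by (rule sublinear_add[OF p])
    finally show ?thesis by (simp add: h_def)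
  qed
  have bdd: "bdd_below (h y ` {0..})" for y
    using lb by (intro bdd_belowI2[of _ "- p (- y)"]) auto
  have le: "p' y \<le> h y t" if "t \<ge> 0" for y t
    unfolding p'_def using that by (intro cINF_lower bdd) auto
  show "p' \<le> p" using le[of 0] by (auto simp: le_fun_def h_def)
  show "p' y \<le> p (y + x) - p x" for y using le[of 1 y] by (simp add: h_def)
  show "sublinear p'" unfolding sublinear_def
  proof safe
    fix y z
    have "p' (y + z) \<le> h y s + h z t" if "s \<ge> 0" "t \<ge> 0" for s t
    proof -
      have "p' (y + z) \<le> h (y + z) (s + t)" using that by (intro le) auto
      also have "\<dots> \<le> h y s + h z t"
        using sublinear_add[OF p, of "y + s *\<^sub>R x" "z + t *\<^sub>R x"]
        by (simp add: h_def algebra_simps)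
      finally show ?thesis .
    qed
    then have "p' (y + z) - h y s \<le> p' z" if "s \<ge> 0" for s
      using that unfolding p'_def[of z] by (intro cINF_greatest) (auto simp: algebra_simps)
    then have "p' (y + z) - p' z \<le> p' y"
      unfolding p'_def[of y] by (intro cINF_greatest) (auto simp: algebra_simps)
    then show "p' (y + z) \<le> p' y + p' z" by simp
  next
    fix y and c :: real assume c: "c \<ge> 0"
    show "p' (c *\<^sub>R y) \<le> c * p' y"
    proof (cases "c = 0")
      case True
      then show ?thesis using le[of 0 0] sublinear_zero[OF p] by (simp add: h_def)
    next
      case False
      have "p' (c *\<^sub>R y) / c \<le> h y t" if "t \<ge> 0" for t
      proof -
        have "p' (c *\<^sub>R y) \<le> h (c *\<^sub>R y) (c * t)" using that c by (intro le) auto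
        also have "\<dots> \<le> c * h y t"
          using sublinear_scale_le[OF p c, of "y + t *\<^sub>R x"] by (simp add: h_def algebra_simps)
        finally show ?thesis using c False by (simp add: field_simps)
      qed
      then have "p' (c *\<^sub>R y) / c \<le> p' y"
        unfolding p'_def[of y] by (intro cINF_greatest) auto
      then show ?thesis using c False by (simp add: field_simps)
    qed
  qed
qed

text \<open>Supplies lower bounds for Zorn's lemma. Totality of the order gives subadditivity: two
  members chosen for the two summands are replaced by the smaller one.\<close>

lemma sublinear_INF_chain:
  fixes C :: "('a::real_vector \<Rightarrow> real) set"
  assumes C: "C \<noteq> {}" "\<And>p. p \<in> C \<Longrightarrow> sublinear p" "\<And>p p'. p \<in> C \<Longrightarrow> p' \<in> C \<Longrightarrow> p \<le> p' \<or> p' \<le> p"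
    and bdd: "\<And>x. bdd_below ((\<lambda>p. p x) ` C)"
  shows "sublinear (\<lambda>x. INF p\<in>C. p x)"
proof -
  define u where "u x = (INF p\<in>C. p x)" for x
  have le: "u x \<le> p x" if "p \<in> C" for p x
    unfolding u_def using that by (intro cINF_lower bdd) auto
  have "sublinear u" unfolding sublinear_def
  proof safe
    fix x y
    have le2: "u (x + y) \<le> p x + p' y" if "p \<in> C" "p' \<in> C" for p p'
    proof -
      obtain r where r: "r \<in> C" "r \<le> p" "r \<le> p'" using C(3) \<open>p \<in> C\<close> \<open>p' \<in> C\<close> by blast
      then have "u (x + y) \<le> r x + r y"
        using le[of r "x + y"] sublinear_add[OF C(2), of r x y] by linarith
      with r show ?thesis by (meson add_mono le_funD order_trans)
    qed
    have "u (x + y) - p x \<le> u y" if "p \<in> C" for p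
      unfolding u_def[of y]
    proof (rule cINF_greatest[OF C(1)])
      fix p' assume "p' \<in> C"
      then show "u (x + y) - p x \<le> p' y" using le2[OF that] by force
    qed
    then have "u (x + y) - u y \<le> u x"
      using C(1) unfolding u_def[of x] by (intro cINF_greatest) (auto simp: le_diff_eq add.commute diff_le_eq)
    then show "u (x + y) \<le> u x + u y" by simp
  next
    fix x and c :: real assume c: "c \<ge> 0"
    show "u (c *\<^sub>R x) \<le> c * u x"
    proof (cases "c = 0")
      case True
      then show ?thesis using C(1) le[of _ 0] sublinear_zero[OF C(2)] by fastforce
    next
      case False
      have "u (c *\<^sub>R x) / c \<le> p x" if "p \<in> C" for p
        using le[OF that, of "c *\<^sub>R x"] sublinear_scale[OF C(2)[OF that] c, of x] c False
        by (simp add: field_simps)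
      then have "u (c *\<^sub>R x) / c \<le> u x"
        using C(1) unfolding u_def[of x] by (intro cINF_greatest) auto
      then show ?thesis using c False by (simp add: field_simps)
    qed
  qed
  then show ?thesis by (simp add: u_def[abs_def])
qed

text \<open>Sublinear functionals that are minimal in the pointwise order are linear.\<close>

theorem norming_functional_real:
  fixes x0 :: "'a::real_normed_vector"
  obtains \<psi> where "linear \<psi>" "\<And>x. \<psi> x \<le> norm x" "norm x0 \<le> \<psi> x0"
proof -
  have "sublinear (norm :: 'a \<Rightarrow> real)"
    by (simp add: sublinear_def norm_triangle_ineq)
  \<comment> \<open>Starting below \<open>p0\<close> instead of the norm builds in the norming
    property: at y = - x0 the bound gives p0 (- x0) <= - norm x0, which a linear p below
    \<open>p0\<close> turns into norm x0 <= p x0.\<close>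
  from sublinear_descend[OF this, of x0] obtain p0 :: "'a \<Rightarrow> real" where
    p0: "sublinear p0" "p0 \<le> norm" "\<And>y. p0 y \<le> norm (y + x0) - norm x0" by blast
  define A where "A = {p. sublinear p \<and> p \<le> p0}"
  have lb: "- norm x \<le> p x" if "p \<in> A" for p x
  proof -
    have "p (- x) \<le> norm (- x)" "sublinear p"
      using that p0(2) unfolding A_def by (auto dest!: le_funD[of _ _ "- x"])
    with sublinear_ge_minus[of p x] show ?thesis by simp
  qed
  \<comment> \<open>The order is reversed, so that Zorn's lemma yields a minimal element.\<close>
  let ?R = "relation_of (\<lambda>a b. b \<le> a) A"
  have "\<exists>m\<in>A. \<forall>a\<in>A. a \<le> m \<longrightarrow> a = m"
  proof (rule predicate_Zorn)
    show "partial_order_on A ?R"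
      by (rule partial_order_on_relation_ofI) auto
    fix C assume "C \<in> Chains ?R"
    then have C: "C \<subseteq> A" "\<And>p p'. p \<in> C \<Longrightarrow> p' \<in> C \<Longrightarrow> p \<le> p' \<or> p' \<le> p"
      by (auto simp: Chains_def relation_of_def)
    show "\<exists>u\<in>A. \<forall>a\<in>C. u \<le> a"
    proof (cases "C = {}")
      case True
      then show ?thesis using p0(1) by (auto simp: A_def)
    next
      case False
      have bdd: "bdd_below ((\<lambda>p. p x) ` C)" for x
        using lb C(1) by (intro bdd_belowI2[of _ "- norm x"]) auto
      let ?u = "\<lambda>x. INF p\<in>C. p x"
      have "sublinear ?u"
        using C False bdd by (intro sublinear_INF_chain) (auto simp: A_def)
      moreover have le: "\<forall>a\<in>C. ?u \<le> a"
        by (auto simp: le_fun_def intro!: cINF_lower bdd)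
      moreover have "?u \<le> p0"
        using le False C(1) unfolding A_def by (blast intro: order_trans)
      ultimately show ?thesis by (auto simp: A_def)
    qed
  qed
  then obtain p where p: "p \<in> A" "\<And>a. a \<in> A \<Longrightarrow> a \<le> p \<Longrightarrow> a = p" by blast
  then have sub: "sublinear p" and le: "p \<le> p0" by (auto simp: A_def)
  have add: "p (y + x) = p y + p x" for x y
  proof -
    from sublinear_descend[OF sub, of x] obtain p' where
      p': "sublinear p'" "p' \<le> p" "\<And>y. p' y \<le> p (y + x) - p x" by blast
    with p le have "p' = p" by (intro p(2)) (auto simp: A_def)
    with p'(3)[of y] have "p y \<le> p (y + x) - p x" by simp
    with sublinear_add[OF sub, of y x] show ?thesis by simp
  qed
  have neg: "p (- x) = - p x" for x
    using add[of "- x" x] sublinear_zero[OF sub] by simp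
  have "linear p"
  proof
    show "p (c *\<^sub>R x) = c *\<^sub>R p x" for c x
    proof (cases "c \<ge> 0")
      case False
      then show ?thesis
        using sublinear_scale[OF sub, of "- c" x] neg[of "c *\<^sub>R x"] by simp
    qed (simp add: sublinear_scale[OF sub])
  qed (rule add)
  moreover have "p x \<le> norm x" for x
    using le p0(2) by (meson le_funD order_trans)
  moreover have "norm x0 \<le> p x0"
    using p0(3)[of "- x0"] le_funD[OF le, of "- x0"] neg[of x0] by simp
  ultimately show ?thesis using that by blast
qed

text \<open>The bound \<open>2\<close> comes from complexifying a real functional of norm \<open>1\<close> by the triangle
  inequality; the sharp constant is not needed.\<close>

definition functionals :: "('e::complex_banach \<Rightarrow> complex) set" where
  "functionals = {\<phi>. (\<forall>x y. \<phi> (x + y) = \<phi> x + \<phi> y) \<and> (\<forall>c x. \<phi> (c *\<^sub>C x) = c * \<phi> x) \<and>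
     (\<forall>x. cmod (\<phi> x) \<le> 2 * norm x)}"

lemma bounded_bilinear_scaleC: "bounded_bilinear ((*\<^sub>C) :: complex \<Rightarrow> 'e::complex_banach \<Rightarrow> 'e)"
proof
  fix a b :: complex and x y :: 'e and r :: real
  show "(a + b) *\<^sub>C x = a *\<^sub>C x + b *\<^sub>C x" by (rule scaleC_add_left)
  show "a *\<^sub>C (x + y) = a *\<^sub>C x + a *\<^sub>C y" by (rule scaleC_add_right)
  show "(r *\<^sub>R a) *\<^sub>C x = r *\<^sub>R a *\<^sub>C x"
    by (simp add: scaleC_scaleC scaleR_conv_of_real flip: scaleC_of_real)
  show "a *\<^sub>C r *\<^sub>R x = r *\<^sub>R a *\<^sub>C x"
    by (simp add: scaleC_scaleC mult.commute flip: scaleC_of_real)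
  show "\<exists>K. \<forall>a x. norm (a *\<^sub>C (x::'e)) \<le> norm a * norm x * K"
    by (rule exI[of _ 1]) (simp add: norm_scaleC)
qed

interpretation scaleC: bounded_bilinear "(*\<^sub>C) :: complex \<Rightarrow> 'e::complex_banach \<Rightarrow> 'e"
  by (rule bounded_bilinear_scaleC)

lemma scaleC_one [simp]: "1 *\<^sub>C (x::'e::complex_banach) = x"
  using scaleC_of_real[of 1 x] by simp

lemma norming_functional:
  fixes x0 :: "'e::complex_banach"
  obtains \<phi> where "\<phi> \<in> functionals" "norm x0 \<le> cmod (\<phi> x0)"
proof -
  obtain \<psi> :: "'e \<Rightarrow> real" where \<psi>: "linear \<psi>" "\<And>x. \<psi> x \<le> norm x" "norm x0 \<le> \<psi> x0"
    using norming_functional_real by blast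
  have abs: "\<bar>\<psi> x\<bar> \<le> norm x" for x
    using \<psi>(2)[of x] \<psi>(2)[of "- x"] linear_neg[OF \<psi>(1), of x] by simp
  \<comment> \<open>The complexification \<open>\<psi> x - \<i> * \<psi> (\<i> *\<^sub>C x)\<close>:
    a complex linear map is recovered from its real part in this way.\<close>
  define \<phi> where "\<phi> x = Complex (\<psi> x) (- \<psi> (\<i> *\<^sub>C x))" for x
  have decomp: "c *\<^sub>C x = Re c *\<^sub>R x + Im c *\<^sub>R \<i> *\<^sub>C x" for c x
  proof -
    have "c = of_real (Re c) + of_real (Im c) * \<i>"
      by (simp add: complex_eq_iff)
    then have "c *\<^sub>C x = (of_real (Re c) + of_real (Im c) * \<i>) *\<^sub>C x"
      by (rule arg_cong)
    then show ?thesis by (simp add: scaleC_add_left scaleC_of_real flip: scaleC_scaleC)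
  qed
  have "\<phi> \<in> functionals" unfolding functionals_def
  proof safe
    show "\<phi> (x + y) = \<phi> x + \<phi> y" for x y
      by (simp add: \<phi>_def complex_eq_iff linear_add[OF \<psi>(1)] scaleC_add_right)
    show "\<phi> (c *\<^sub>C x) = c * \<phi> x" for c x
    proof -
      have "\<i> *\<^sub>C \<i> *\<^sub>C x = - x" by (simp add: scaleC_scaleC decomp[of "-1"])
      then have "\<i> *\<^sub>C c *\<^sub>C x = Re c *\<^sub>R \<i> *\<^sub>C x - Im c *\<^sub>R x"
        by (simp add: decomp[of c] scaleC_add_right scaleC.scaleR_right)
      then have "\<psi> (\<i> *\<^sub>C c *\<^sub>C x) = Re c * \<psi> (\<i> *\<^sub>C x) - Im c * \<psi> x"
        by (simp add: linear_diff[OF \<psi>(1)] linear_scale[OF \<psi>(1)])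
      moreover have "\<psi> (c *\<^sub>C x) = Re c * \<psi> x + Im c * \<psi> (\<i> *\<^sub>C x)"
        by (simp add: decomp[of c x] linear_add[OF \<psi>(1)] linear_scale[OF \<psi>(1)])
      ultimately show ?thesis
        by (simp add: \<phi>_def complex_eq_iff)
    qed
    show "cmod (\<phi> x) \<le> 2 * norm x" for x
      using cmod_le[of "\<phi> x"] abs[of x] abs[of "\<i> *\<^sub>C x"] by (simp add: \<phi>_def norm_scaleC)
  qed
  moreover have "norm x0 \<le> cmod (\<phi> x0)"
    using \<psi>(3) abs_Re_le_cmod[of "\<phi> x0"] by (simp add: \<phi>_def)
  ultimately show ?thesis using that by blast
qed

lemma functionals_bounded_linear:
  assumes "\<phi> \<in> functionals" shows "bounded_linear \<phi>"
proof (rule bounded_linear_intro[where K = 2])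
  show "\<phi> (r *\<^sub>R x) = r *\<^sub>R \<phi> x" for r x
    using assms by (simp add: functionals_def scaleR_conv_of_real flip: scaleC_of_real)
qed (use assms in \<open>auto simp: functionals_def mult.commute\<close>)

lemma functionals_scaleC: "\<phi> \<in> functionals \<Longrightarrow> \<phi> (c *\<^sub>C x) = c * \<phi> x"
  and functionals_bound: "\<phi> \<in> functionals \<Longrightarrow> cmod (\<phi> x) \<le> 2 * norm x"
  by (auto simp: functionals_def)

lemma norm_le_functionals:
  fixes x :: "'e::complex_banach"
  assumes "\<And>\<phi>. \<phi> \<in> functionals \<Longrightarrow> cmod (\<phi> x) \<le> B" shows "norm x \<le> B"
proof -
  obtain \<phi> where "\<phi> \<in> functionals" "norm x \<le> cmod (\<phi> x)" by (rule norming_functional)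
  with assms[of \<phi>] show ?thesis by simp
qed

lemma functionals_separate:
  fixes x y :: "'e::complex_banach"
  assumes "\<And>\<phi>. \<phi> \<in> functionals \<Longrightarrow> \<phi> x = \<phi> y" shows "x = y"
proof -
  have "norm (x - y) \<le> 0"
  proof (rule norm_le_functionals)
    fix \<phi> :: "'e \<Rightarrow> complex" assume \<phi>: "\<phi> \<in> functionals"
    then interpret bounded_linear \<phi> by (rule functionals_bounded_linear)
    show "cmod (\<phi> (x - y)) \<le> 0" using assms[OF \<phi>] by (simp add: diff)
  qed
  then show ?thesis by simp
qed

section \<open>Vector-valued holomorphic functions\<close>

lemma holomorphic_on_functional:
  assumes "f vholomorphic_on S" "\<phi> \<in> functionals"
  shows "(\<lambda>z. \<phi> (f z)) holomorphic_on S"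
  unfolding holomorphic_on_def
proof
  fix z assume "z \<in> S"
  then obtain D where "(f has_derivative (\<lambda>h. h *\<^sub>C D)) (at z within S)"
    using assms(1) by (auto simp: vholomorphic_on_def)
  from bounded_linear.has_derivative[OF functionals_bounded_linear[OF assms(2)] this]
  have "((\<lambda>z. \<phi> (f z)) has_field_derivative \<phi> D) (at z within S)"
    by (simp add: functionals_scaleC[OF assms(2)] has_field_derivative_def mult.commute[of _ "\<phi> D"])
  then show "(\<lambda>z. \<phi> (f z)) field_differentiable at z within S"
    by (auto simp: field_differentiable_def)
qed

lemma vholomorphic_on_imp_continuous_on: "f vholomorphic_on S \<Longrightarrow> continuous_on S f"
  unfolding vholomorphic_on_def continuous_on_eq_continuous_within
  by (meson has_derivative_continuous)

lemma vholomorphic_on_subset: "f vholomorphic_on S \<Longrightarrow> T \<subseteq> S \<Longrightarrow> f vholomorphic_on T"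
  unfolding vholomorphic_on_def by (meson has_derivative_subset subsetD)

text \<open>Holomorphy is local. This serves functions described by a different formula near each
  point, such as the integrals below whose contour depends on the point.\<close>

lemma vholomorphic_on_open_cover:
  assumes "\<And>z. z \<in> S \<Longrightarrow> \<exists>T g. open T \<and> z \<in> T \<and> g vholomorphic_on T \<and> (\<forall>w\<in>T. f w = g w)"
  shows "f vholomorphic_on S"
  unfolding vholomorphic_on_def
proof
  fix z assume "z \<in> S"
  from assms[OF this] obtain T g where T: "open T" "z \<in> T" "g vholomorphic_on T" "\<forall>w\<in>T. f w = g w"
    by blast
  then obtain D where "(g has_derivative (\<lambda>h. h *\<^sub>C D)) (at z)"
    unfolding vholomorphic_on_def using at_within_open[of z T] by metis
  from has_derivative_transform_within_open[OF this T(1,2)] T(4)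
  have "(f has_derivative (\<lambda>h. h *\<^sub>C D)) (at z)" by simp
  then show "\<exists>D. (f has_derivative (\<lambda>h. h *\<^sub>C D)) (at z within S)"
    by (blast intro: has_derivative_at_withinI)
qed

text \<open>Taylor's formula of order one, with the Cauchy estimate 2 M / (R/4)^2 = 32 M / R^2 for
  the second derivative on \<open>ball z (R/2)\<close>. The bound sees g only through M and R, hence
  is uniform over all functionals.\<close>

lemma diff_quotient_deriv_bound:
  assumes g: "g holomorphic_on ball z R" and M: "\<And>w. w \<in> ball z R \<Longrightarrow> cmod (g w) \<le> M"
    and h: "h \<noteq> 0" "cmod h < R / 2"
  shows "cmod ((g (z + h) - g z) / h - deriv g z) \<le> 32 * M / R\<^sup>2 * cmod h"
proof -
  have R: "R > 0" using h norm_ge_zero[of h] by linarith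
  let ?f = "\<lambda>i. (deriv ^^ i) g"
  have "cmod (?f 0 (z + h) - (\<Sum>i\<le>1. ?f i z * (z + h - z) ^ i / fact i))
      \<le> 32 * M / R\<^sup>2 * cmod (z + h - z) ^ Suc 1 / fact 1"
  proof (rule complex_Taylor[of "ball z (R/2)"])
    fix i x assume "x \<in> ball z (R/2)"
    then have x: "x \<in> ball z R" using R by simp
    have "?f i holomorphic_on ball z R" using g by (intro holomorphic_higher_deriv) auto
    then show "(?f i has_field_derivative ?f (Suc i) x) (at x within ball z (R/2))"
      using holomorphic_derivI[OF _ open_ball x] by simp
  next
    fix x assume x: "x \<in> ball z (R/2)"
    have sub: "cball x (R/4) \<subseteq> ball z R"
    proof
      fix y assume "y \<in> cball x (R/4)"
      with x R show "y \<in> ball z R"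
        using dist_triangle[of z y x] by simp
    qed
    then have "cmod ((deriv ^^ 2) g x) \<le> fact 2 * M / (R/4) ^ 2"
    proof (intro Cauchy_inequality)
      show "g holomorphic_on ball x (R/4)"
        using holomorphic_on_subset[OF g] sub ball_subset_cball by blast
      show "continuous_on (cball x (R/4)) g"
        using holomorphic_on_imp_continuous_on[OF g] sub continuous_on_subset by blast
      show "cmod (g y) \<le> M" if "cmod (x - y) = R/4" for y
        using sub that by (intro M) (auto simp: dist_norm subset_iff)
    qed (use R in auto)
    then show "cmod (?f (Suc 1) x) \<le> 32 * M / R\<^sup>2"
      by (simp add: numeral_2_eq_2 power_divide)
  qed (use R h in \<open>auto simp: dist_norm\<close>)
  then have "cmod (g (z + h) - g z - deriv g z * h) \<le> 32 * M / R\<^sup>2 * (cmod h)\<^sup>2"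
    by (simp add: diff_diff_eq power2_eq_square)
  moreover have "(g (z + h) - g z) / h - deriv g z = (g (z + h) - g z - deriv g z * h) / h"
    using h by (simp add: field_simps)
  ultimately show ?thesis
    using h by (simp add: norm_divide divide_le_eq power2_eq_square mult.assoc)
qed

text \<open>Difference quotients are uniformly Cauchy, because the functionals see them
  converge at a rate that depends only on a bound for the function.\<close>

theorem weakly_holomorphic_imp_vholomorphic:
  fixes F :: "complex \<Rightarrow> 'e::complex_banach"
  assumes weak: "\<And>\<phi>. \<phi> \<in> functionals \<Longrightarrow> (\<lambda>z. \<phi> (F z)) holomorphic_on S"
    and bdd: "\<And>z. z \<in> S \<Longrightarrow> \<exists>R>0. \<exists>M. ball z R \<subseteq> S \<and> (\<forall>w\<in>ball z R. norm (F w) \<le> M)"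
  shows "F vholomorphic_on S"
  unfolding vholomorphic_on_def
proof
  fix z assume "z \<in> S"
  from bdd[OF this] obtain R M where R: "R > 0" "ball z R \<subseteq> S" "\<And>w. w \<in> ball z R \<Longrightarrow> norm (F w) \<le> M"
    by blast
  define q where "q h = inverse h *\<^sub>C (F (z + h) - F z)" for h
  \<comment> \<open>Functionals are bounded by \<open>2 * norm\<close>, so \<open>2 * M\<close>
    takes the place of \<open>M\<close> and 32 becomes 64.\<close>
  define K where "K = 64 * M / R\<^sup>2"
  have q: "norm (q h - q h') \<le> K * (cmod h + cmod h')"
    if h: "h \<noteq> 0" "cmod h < R/2" and h': "h' \<noteq> 0" "cmod h' < R/2" for h h'
  proof (rule norm_le_functionals)
    fix \<phi> :: "'e \<Rightarrow> complex" assume \<phi>: "\<phi> \<in> functionals"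
    interpret bounded_linear \<phi> by (rule functionals_bounded_linear[OF \<phi>])
    let ?g = "\<lambda>z. \<phi> (F z)"
    have g: "?g holomorphic_on ball z R" using weak[OF \<phi>] R(2) by (rule holomorphic_on_subset)
    have gM: "cmod (?g w) \<le> 2 * M" if "w \<in> ball z R" for w
      using functionals_bound[OF \<phi>, of "F w"] R(3)[OF that] by linarith
    have eq: "\<phi> (q h) = (?g (z + h) - ?g z) / h" for h
      by (simp add: q_def functionals_scaleC[OF \<phi>] diff field_simps)
    have "cmod (\<phi> (q h) - deriv ?g z) \<le> K * cmod h" "cmod (\<phi> (q h') - deriv ?g z) \<le> K * cmod h'"
      using diff_quotient_deriv_bound[OF g gM h] diff_quotient_deriv_bound[OF g gM h']
      by (simp_all add: eq K_def)
    moreover have "\<phi> (q h - q h') = (\<phi> (q h) - deriv ?g z) - (\<phi> (q h') - deriv ?g z)"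
      by (simp add: diff)
    ultimately show "cmod (\<phi> (q h - q h')) \<le> K * (cmod h + cmod h')"
      using norm_triangle_ineq4[of "\<phi> (q h) - deriv ?g z" "\<phi> (q h') - deriv ?g z"]
      by (simp only: distrib_left)
  qed
  \<comment> \<open>Any null sequence of admissible increments would do: completeness provides the
    limit D along it, and the uniform estimate \<open>q\<close> extends the limit to all
    increments.\<close>
  define x where "x n = complex_of_real (R / 4 / real (Suc n))" for n
  have x0: "x \<longlonglongrightarrow> 0"
  proof -
    have "(\<lambda>n. R / 4 / real (Suc n)) \<longlonglongrightarrow> 0" by real_asymp
    from tendsto_of_real[OF this, where ?'a = complex] show ?thesis unfolding x_def by simp
  qed
  have xn: "x n \<noteq> 0" "cmod (x n) < R/2" for n
  proof -
    have "R / 4 / real (Suc n) \<le> R / 4 / 1" using R(1) by (intro divide_left_mono) auto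
    moreover have "cmod (x n) = R / 4 / real (Suc n)"
      unfolding x_def norm_of_real using R(1) by (simp del: of_nat_Suc)
    ultimately show "cmod (x n) < R/2" using R(1) by linarith
  qed (use R(1) in \<open>simp add: x_def del: of_nat_Suc\<close>)
  have "Cauchy (\<lambda>n. q (x n))"
  proof (rule CauchyI)
    fix e :: real assume e: "e > 0"
    have "(\<lambda>n. K * cmod (x n)) \<longlonglongrightarrow> K * 0"
      using x0 by (intro tendsto_intros tendsto_norm_zero)
    from order_tendstoD(2)[OF this, of "e/2"] e obtain N where
      N: "\<And>n. n \<ge> N \<Longrightarrow> K * cmod (x n) < e/2" by (auto simp: eventually_sequentially)
    show "\<exists>N. \<forall>m\<ge>N. \<forall>n\<ge>N. norm (q (x m) - q (x n)) < e"
    proof (intro exI allI impI)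
      fix m n assume "m \<ge> N" "n \<ge> N"
      with N[of m] N[of n] q[OF xn xn, of m n] show "norm (q (x m) - q (x n)) < e"
        by (simp add: algebra_simps)
    qed
  qed
  then obtain D where D: "(\<lambda>n. q (x n)) \<longlonglongrightarrow> D"
    using Cauchy_convergent convergent_def by blast
  have qD: "norm (q h - D) \<le> K * cmod h" if h: "h \<noteq> 0" "cmod h < R/2" for h
  proof (rule LIMSEQ_le)
    show "(\<lambda>n. norm (q h - q (x n))) \<longlonglongrightarrow> norm (q h - D)" by (intro tendsto_intros D)
    show "(\<lambda>n. K * (cmod h + cmod (x n))) \<longlonglongrightarrow> K * cmod h"
      using x0 by (auto intro!: tendsto_eq_intros tendsto_norm_zero)
    show "\<exists>N. \<forall>n\<ge>N. norm (q h - q (x n)) \<le> K * (cmod h + cmod (x n))"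
      using q[OF h xn] by blast
  qed
  have "(F has_derivative (\<lambda>h. h *\<^sub>C D)) (at z within S)"
  proof (rule has_derivativeI_sandwich)
    show "R/2 > 0" using R(1) by simp
    show "bounded_linear (\<lambda>h. h *\<^sub>C D)" by (rule scaleC.bounded_linear_left)
    fix y assume y: "y \<noteq> z" "dist y z < R/2"
    define h where "h = y - z"
    have h: "h \<noteq> 0" "cmod h < R/2" using y by (auto simp: h_def dist_norm)
    have "h *\<^sub>C (q h - D) = F y - F z - h *\<^sub>C D"
      using h by (simp add: scaleC.diff_right q_def scaleC_scaleC scaleC_add_right h_def)
    then have "norm (F y - F z - (y - z) *\<^sub>C D) = cmod h * norm (q h - D)"
      by (simp add: h_def flip: norm_scaleC)
    then show "norm (F y - F z - (y - z) *\<^sub>C D) / norm (y - z) \<le> K * cmod (y - z)"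
      using qD[OF h] h by (simp add: h_def)
  next
    have "((\<lambda>y. K * cmod (y - z)) \<longlongrightarrow> K * cmod (z - z)) (at z within S)"
      by (intro tendsto_intros)
    then show "((\<lambda>y. K * cmod (y - z)) \<longlongrightarrow> 0) (at z within S)" by simp
  qed
  then show "\<exists>D. (F has_derivative (\<lambda>h. h *\<^sub>C D)) (at z within S)" by blast
qed

lemma vholomorphic_on_unique:
  fixes F G :: "complex \<Rightarrow> 'e::complex_banach"
  assumes "open U" "U \<noteq> {}" "U \<subseteq> S" "open S" "connected S"
    and "F vholomorphic_on S" "G vholomorphic_on S" "\<And>z. z \<in> U \<Longrightarrow> F z = G z" "z \<in> S"
  shows "F z = G z"
proof (rule functionals_separate)
  fix \<phi> :: "'e \<Rightarrow> complex" assume \<phi>: "\<phi> \<in> functionals"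
  show "\<phi> (F z) = \<phi> (G z)"
    by (rule analytic_continuation_open[of U S "\<lambda>z. \<phi> (F z)" "\<lambda>z. \<phi> (G z)"])
      (use assms \<phi> in \<open>auto intro: holomorphic_on_functional\<close>)
qed

section \<open>Vector-valued power series\<close>

lemma power_series_coeff_bound:
  fixes a :: "nat \<Rightarrow> 'e::complex_banach"
  assumes "summable (\<lambda>n. t ^ n *\<^sub>C a n)"
  obtains C where "C > 0" "\<And>n. norm (a n) * cmod t ^ n \<le> C"
proof -
  obtain C where "C > 0" "\<And>n. norm (t ^ n *\<^sub>C a n) \<le> C"
    using summable_imp_bounded[OF assms] by (auto simp: bounded_pos)
  then show ?thesis using that by (simp add: norm_scaleC norm_power mult.commute)
qed

lemma power_series_abs_summable:
  fixes a :: "nat \<Rightarrow> 'e::complex_banach"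
  assumes "\<And>n. norm (a n) * s ^ n \<le> C" "cmod t \<le> x" "x < s"
  shows "summable (\<lambda>n. t ^ n *\<^sub>C a n)" "norm (\<Sum>n. t ^ n *\<^sub>C a n) \<le> (\<Sum>n. C * (x / s) ^ n)"
proof -
  have x: "0 \<le> x" "s > 0" using assms(2,3) norm_ge_zero[of t] by linarith+
  have le: "norm (t ^ n *\<^sub>C a n) \<le> C * (x / s) ^ n" for n
  proof -
    have "norm (t ^ n *\<^sub>C a n) \<le> x ^ n * norm (a n)"
      using assms(2) by (simp add: norm_scaleC norm_power mult_right_mono power_mono)
    also have "\<dots> = (x / s) ^ n * (norm (a n) * s ^ n)" using x by (simp add: power_divide)
    also have "\<dots> \<le> (x / s) ^ n * C" using x by (intro mult_left_mono assms) auto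
    finally show ?thesis by (simp add: mult.commute)
  qed
  have s: "summable (\<lambda>n. C * (x / s) ^ n)"
    using x assms(3) by (intro summable_mult summable_geometric) auto
  show "summable (\<lambda>n. t ^ n *\<^sub>C a n)"
    by (rule summable_comparison_test'[OF s]) (rule le)
  show "norm (\<Sum>n. t ^ n *\<^sub>C a n) \<le> (\<Sum>n. C * (x / s) ^ n)"
    by (rule norm_suminf_le[OF le s])
qed

lemma functional_sums:
  assumes "\<phi> \<in> functionals" "(\<lambda>n. t ^ n *\<^sub>C a n) sums f"
  shows "(\<lambda>n. \<phi> (a n) * t ^ n) sums \<phi> f"
  using bounded_linear.sums[OF functionals_bounded_linear[OF assms(1)] assms(2)]
  by (simp add: functionals_scaleC[OF assms(1)] mult.commute)

lemma power_series_vholomorphic: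
  fixes a :: "nat \<Rightarrow> 'e::complex_banach"
  assumes sums: "\<And>t. t \<in> ball 0 r \<Longrightarrow> (\<lambda>n. t ^ n *\<^sub>C a n) sums f t"
  shows "f vholomorphic_on ball 0 r"
proof (rule weakly_holomorphic_imp_vholomorphic)
  fix \<phi> :: "'e \<Rightarrow> complex" assume "\<phi> \<in> functionals"
  then show "(\<lambda>z. \<phi> (f z)) holomorphic_on ball 0 r"
    using functional_sums[OF _ sums] by (intro power_series_holomorphic[where a = "\<lambda>n. \<phi> (a n)"]) simp
next
  fix z assume z: "z \<in> ball (0::complex) r"
  \<comment> \<open>The gap between \<open>cmod z\<close> and r is cut into thirds: the
    neighbourhood of z reaches up to \<open>cmod z + \<delta>\<close>, and the coefficients are
    bounded at the radius \<open>s = cmod z + 2 * \<delta>\<close>, still below r. This leaves a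
    geometric majorant.\<close>
  define \<delta> where "\<delta> = (r - cmod z) / 3"
  have \<delta>: "\<delta> > 0" using z by (simp add: \<delta>_def)
  define s where "s = cmod z + 2 * \<delta>"
  have s: "0 < s" "s < r" using \<delta> by (auto simp: s_def add_nonneg_pos) (simp add: \<delta>_def field_simps)
  then have "summable (\<lambda>n. complex_of_real s ^ n *\<^sub>C a n)"
    using sums[of "of_real s"] by (auto simp: sums_iff)
  then obtain C where C: "\<And>n. norm (a n) * s ^ n \<le> C"
    using power_series_coeff_bound s by (metis norm_of_real abs_of_pos)
  have sub: "ball z \<delta> \<subseteq> ball 0 r" 
  proof
    fix w assume "w \<in> ball z \<delta>"
    then show "w \<in> ball 0 r" using norm_triangle_sub[of w z] \<delta> s
      by (simp add: dist_norm norm_minus_commute s_def)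
  qed
  moreover have "norm (f w) \<le> (\<Sum>n. C * ((cmod z + \<delta>) / s) ^ n)" if w: "w \<in> ball z \<delta>" for w
  proof -
    have "cmod w \<le> cmod z + \<delta>" using norm_triangle_sub[of w z] w
      by (simp add: dist_norm norm_minus_commute)
    from power_series_abs_summable(2)[OF C this] show ?thesis
      using sums[of w] w sub \<delta> by (auto simp: sums_iff s_def)
  qed
  ultimately show "\<exists>R>0. \<exists>M. ball z R \<subseteq> ball 0 r \<and> (\<forall>w\<in>ball z R. norm (f w) \<le> M)"
    using \<delta> by blast
qed

lemma vholomorphic_on_add:
  assumes "f vholomorphic_on S" "g vholomorphic_on S"
  shows "(\<lambda>z. f z + g z) vholomorphic_on S"
  unfolding vholomorphic_on_def
proof
  fix z assume z: "z \<in> S"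
  from assms z obtain D D' where "(f has_derivative (\<lambda>h. h *\<^sub>C D)) (at z within S)"
    "(g has_derivative (\<lambda>h. h *\<^sub>C D')) (at z within S)"
    unfolding vholomorphic_on_def by blast
  from has_derivative_add[OF this]
  show "\<exists>D. ((\<lambda>z. f z + g z) has_derivative (\<lambda>h. h *\<^sub>C D)) (at z within S)"
    by (auto simp flip: scaleC_add_right)
qed

lemma holomorphic_imp_vholomorphic_scaleC:
  assumes "g holomorphic_on S"
  shows "(\<lambda>z. g z *\<^sub>C x) vholomorphic_on S"
  unfolding vholomorphic_on_def
proof
  fix z assume z: "z \<in> S"
  from assms z obtain D where "(g has_field_derivative D) (at z within S)"
    unfolding holomorphic_on_def field_differentiable_def by blast
  then have "(g has_derivative (*) D) (at z within S)"
    by (simp add: has_field_derivative_def)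
  from bounded_linear.has_derivative[OF scaleC.bounded_linear_left this]
  show "\<exists>D. ((\<lambda>z. g z *\<^sub>C x) has_derivative (\<lambda>h. h *\<^sub>C D)) (at z within S)"
    by (intro exI[of _ "D *\<^sub>C x"]) (simp add: scaleC_scaleC mult.commute)
qed

section \<open>Geometry of sectors and disc-sectors\<close>

lemma sector_eq_exp_image: "sector d \<alpha> = exp ` {z. d - \<alpha>/2 < Im z \<and> Im z < d + \<alpha>/2}"
proof (intro equalityI subsetI)
  fix z assume "z \<in> sector d \<alpha>"
  then obtain \<rho> \<phi> where z: "z = of_real \<rho> * cis \<phi>" "\<rho> > 0" "d - \<alpha>/2 < \<phi>" "\<phi> < d + \<alpha>/2"
    by (auto simp: sector_def)
  then have "z = exp (Complex (ln \<rho>) \<phi>)" by (simp add: exp_eq_polar exp_of_real)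
  with z show "z \<in> exp ` {z. d - \<alpha>/2 < Im z \<and> Im z < d + \<alpha>/2}" by force
next
  fix z assume "z \<in> exp ` {z. d - \<alpha>/2 < Im z \<and> Im z < d + \<alpha>/2}"
  then obtain w where "z = exp w" "d - \<alpha>/2 < Im w" "Im w < d + \<alpha>/2" by blast
  then show "z \<in> sector d \<alpha>"
    unfolding sector_def mem_Collect_eq greaterThanLessThan_iff using exp_eq_polar[of w] by force
qed

text \<open>The exponential maps a strip onto the sector and is open as a nonconstant holomorphic
  function. This avoids branches of the logarithm, of which an opening above \<open>2 * pi\<close>
  admits none.\<close>

lemma open_sector: "open (sector d \<alpha>)"
  unfolding sector_eq_exp_image
proof (rule open_mapping_thm[where S = UNIV])
  have "open ({z. d - \<alpha>/2 < Im z} \<inter> {z. Im z < d + \<alpha>/2})"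
    by (intro open_Int open_halfspace_Im_gt open_halfspace_Im_lt)
  then show "open {z. d - \<alpha>/2 < Im z \<and> Im z < d + \<alpha>/2}" by (simp add: Collect_conj_eq)
  show "\<not> (exp :: complex \<Rightarrow> complex) constant_on UNIV"
  proof
    assume "(exp :: complex \<Rightarrow> complex) constant_on UNIV"
    then obtain y where y: "\<And>x::complex. exp x = y" by (auto simp: constant_on_def)
    from y[of 0] y[of "\<i> * of_real pi"] show False by simp
  qed
qed (auto intro: holomorphic_intros)

lemma open_disc_sector: "open (disc_sector d \<alpha> r)"
  by (simp add: disc_sector_def open_sector open_Un)

lemma sector_scale: "t \<in> sector d \<alpha> \<Longrightarrow> c > 0 \<Longrightarrow> of_real c * t \<in> sector d \<alpha>"
  unfolding sector_def mem_Collect_eq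
  by (metis mult.assoc mult_pos_pos of_real_mult)

lemma disc_sector_scale:
  assumes "t \<in> disc_sector d \<alpha> r" "0 < c" "c \<le> 1" shows "of_real c * t \<in> disc_sector d \<alpha> r"
proof -
  have "c * cmod t \<le> cmod t" using assms by (simp add: mult_left_le_one_le)
  then show ?thesis using assms sector_scale[of t d \<alpha> c] by (auto simp: disc_sector_def norm_mult)
qed

lemma closed_segment_disc_sector:
  assumes "r > 0" "t \<in> disc_sector d \<alpha> r"
  shows "closed_segment 0 t \<subseteq> disc_sector d \<alpha> r"
proof
  fix w assume "w \<in> closed_segment 0 t"
  then obtain c where c: "0 \<le> c" "c \<le> 1" "w = of_real c * t"
    by (auto simp: in_segment scaleR_conv_of_real)
  show "w \<in> disc_sector d \<alpha> r"
  proof (cases "c = 0")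
    case True
    then show ?thesis using c assms by (simp add: disc_sector_def)
  next
    case False
    then show ?thesis using c assms disc_sector_scale[of t d \<alpha> r c] by simp
  qed
qed

lemma connected_disc_sector:
  assumes "r > 0" shows "connected (disc_sector d \<alpha> r)"
proof (rule starlike_imp_connected)
  have "0 \<in> disc_sector d \<alpha> r" using assms by (simp add: disc_sector_def)
  then show "starlike (disc_sector d \<alpha> r)"
    unfolding starlike_def using closed_segment_disc_sector[OF assms] by blast
qed

text \<open>Such an intersection is the region in which one fixed contour is admissible. Both sets
  are star-shaped about 0, and this survives intersection, unlike mere connectedness.\<close>

lemma connected_disc_sector_ball:
  assumes "r > 0" "R > 0" shows "connected (disc_sector d \<alpha> r \<inter> ball 0 R)"
proof (rule starlike_imp_connected)
  have 0: "0 \<in> disc_sector d \<alpha> r \<inter> ball 0 R" using assms by (simp add: disc_sector_def)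
  moreover have "closed_segment 0 t \<subseteq> ball 0 R" if "t \<in> ball 0 R" for t :: complex
    using that assms by (intro closed_segment_subset) auto
  ultimately show "starlike (disc_sector d \<alpha> r \<inter> ball 0 R)"
    unfolding starlike_def using closed_segment_disc_sector[OF assms(1)] by blast
qed

lemma disc_sector_mono: "\<alpha> \<le> \<alpha>' \<Longrightarrow> r \<le> r' \<Longrightarrow> disc_sector d \<alpha> r \<subseteq> disc_sector d \<alpha>' r'"
  by (fastforce simp: disc_sector_def sector_def)

section \<open>Rapidly decreasing perturbations\<close>

lemma power_le_fact_exp:
  fixes y :: real assumes "y \<ge> 0" shows "y ^ n \<le> fact n * exp y"
proof -
  have "(\<Sum>i\<in>{n}. y ^ i /\<^sub>R fact i) \<le> exp y"
    unfolding exp_def using assms by (intro sum_le_suminf summable_exp_generic) auto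
  then show ?thesis by (simp add: field_simps)
qed

text \<open>For x > 1 the power is at most (x^k)^(p n), a term of the exponential series of x^k up
  to a factorial. Growth of arbitrarily small order k is thus bought at the price (p n)!.\<close>

lemma power_le_fact_exp_powr:
  fixes x k :: real assumes "x \<ge> 0" "k > 0" "real p * k \<ge> 1"
  shows "x ^ n \<le> fact (p * n) * exp (x powr k)"
proof (cases "x \<le> 1")
  case True
  then have "x ^ n \<le> 1 * 1" using assms(1) by (simp add: power_le_one)
  also have "\<dots> \<le> fact (p * n) * exp (x powr k)" by (intro mult_mono) (auto simp: fact_ge_1)
  finally show ?thesis .
next
  case False
  then have "x ^ n = x powr (1 * n)" by (simp add: powr_realpow)
  also have "\<dots> \<le> x powr ((p * k) * n)"
    using False mult_right_mono[OF assms(3), of "real n"] by (intro powr_mono) auto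
  also have "\<dots> = (x powr k) ^ (p * n)" using False by (simp add: powr_powr mult_ac flip: powr_realpow)
  also have "\<dots> \<le> fact (p * n) * exp (x powr k)" by (intro power_le_fact_exp) simp
  finally show ?thesis .
qed

text \<open>The factorial is at most (p n)^(p n), whose logarithm is of order n log n and so loses
  against n^(3/2).\<close>

lemma summable_superexponential:
  fixes L :: real and p :: nat assumes "L > 0" "p > 0"
  shows "summable (\<lambda>n. exp (- (real n powr (3/2))) * L ^ n * fact (p * n))"
proof (rule summable_comparison_test_ev)
  define P l where "P = real p" "l = ln L"
  have P: "P > 0" using assms by (simp add: P_l_def)
  \<comment> \<open>The summand \<open>2 * ln n\<close> is the reserve that permits comparison with
    1 / n^2.\<close>
  have "filterlim (\<lambda>n. - (real n powr (3/2)) + n * l + P * n * ln (P * n) + 2 * ln n) at_bot sequentially"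
    using P by real_asymp
  then have "\<forall>\<^sub>F n in sequentially. - (real n powr (3/2)) + n * l + P * n * ln (P * n) + 2 * ln n \<le> 0"
    by (simp add: filterlim_at_bot)
  then show "\<forall>\<^sub>F n in sequentially. norm (exp (- (real n powr (3/2))) * L ^ n * fact (p * n)) \<le> 1 / real n ^ 2"
    using eventually_gt_at_top[of 0]
  proof eventually_elim
    case (elim n)
    have "fact (p * n) \<le> real ((p * n) ^ (p * n))" by (rule fact_le_power)
    also have "\<dots> = (P * n) powr (P * n)"
      using elim P by (simp add: P_l_def flip: powr_realpow)
    also have "\<dots> = exp (P * n * ln (P * n))" using elim P by (simp add: powr_def)
    finally have 1: "fact (p * n) \<le> exp (P * n * ln (P * n))" .
    have 2: "L ^ n = exp (n * l)" using assms by (simp add: P_l_def exp_of_nat_mult)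
    have 3: "1 / real n ^ 2 = exp (- 2 * ln n)" using elim by (simp add: exp_minus exp_of_nat_mult[of 2, simplified] field_simps)
    have "exp (- (real n powr (3/2))) * L ^ n * fact (p * n) \<le>
      exp (- (real n powr (3/2))) * exp (n * l) * exp (P * n * ln (P * n))"
      unfolding 2 using 1 by (intro mult_left_mono) auto
    also have "\<dots> = exp (- (real n powr (3/2)) + n * l + P * n * ln (P * n))" by (simp only: exp_add)
    also have "\<dots> \<le> exp (- 2 * ln n)" using elim by simp
    finally show ?case using assms by (simp add: 3)
  qed
  show "summable (\<lambda>n. 1 / real n ^ 2)" by (rule inverse_power_summable[of 2, simplified inverse_eq_divide]) simp
qed

text \<open>Since k is arbitrary, the sum has exponential order 0. With p k >= 1 each term is at
  most exp (|t|^k) times a term of a convergent series free of t.\<close>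

lemma perturbation_entire:
  fixes a :: "nat \<Rightarrow> 'e::complex_banach"
  assumes e: "\<And>n. \<bar>e n\<bar> \<le> C0 * exp (- (real n powr (3/2)))"
    and a: "\<And>n. norm (a n) * \<rho> ^ n \<le> C" "\<rho> > 0" and k: "k > 0"
  shows "summable (\<lambda>n. t ^ n *\<^sub>C e n *\<^sub>R a n)"
    and "\<exists>M. \<forall>t. norm (\<Sum>n. t ^ n *\<^sub>C e n *\<^sub>R a n) \<le> M * exp (cmod t powr k)"
proof -
  define p where "p = nat \<lceil>1 / k\<rceil>"
  have "real p \<ge> 1 / k" unfolding p_def by linarith
  then have p: "p * k \<ge> 1" using k by (simp add: field_simps)
  then have "p > 0" by (cases p) auto
  let ?c = "\<lambda>n. exp (- (real n powr (3/2))) * (1 / \<rho>) ^ n * fact (p * n)"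
  have sum: "summable ?c"
    using a(2) \<open>p > 0\<close> by (intro summable_superexponential) auto
  have "C0 \<ge> 0" using e[of 0] by simp
  have le: "norm (t ^ n *\<^sub>C e n *\<^sub>R a n) \<le> C0 * C * exp (cmod t powr k) * ?c n" for t n
  proof -
    have an: "norm (a n) \<le> C * (1 / \<rho>) ^ n" using a by (simp add: field_simps)
    have "norm (t ^ n *\<^sub>C e n *\<^sub>R a n) = cmod t ^ n * (\<bar>e n\<bar> * norm (a n))"
      by (simp add: norm_scaleC norm_power)
    also have "\<dots> \<le> (fact (p * n) * exp (cmod t powr k)) *
        ((C0 * exp (- (real n powr (3/2)))) * (C * (1 / \<rho>) ^ n))"
      using \<open>C0 \<ge> 0\<close> by (intro mult_mono power_le_fact_exp_powr e an p k mult_nonneg_nonneg) auto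
    finally show ?thesis by (simp add: mult_ac)
  qed
  have sum': "summable (\<lambda>n. C0 * C * exp (cmod t powr k) * ?c n)" for t
    by (intro summable_mult sum)
  show "summable (\<lambda>n. t ^ n *\<^sub>C e n *\<^sub>R a n)"
    by (rule summable_comparison_test'[OF sum' le])
  have "norm (\<Sum>n. t ^ n *\<^sub>C e n *\<^sub>R a n) \<le> C0 * C * suminf ?c * exp (cmod t powr k)" for t
    using norm_suminf_le[OF le sum', of t] suminf_mult[OF sum, of "C0 * C * exp (cmod t powr k)"]
    by (simp add: mult_ac)
  then show "\<exists>M. \<forall>t. norm (\<Sum>n. t ^ n *\<^sub>C e n *\<^sub>R a n) \<le> M * exp (cmod t powr k)" by blast
qed

lemma has_sum_near_0_coeff_bound:
  assumes "has_sum_near_0 u f"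
  obtains \<rho> C where "\<rho> > 0" "C > 0" "\<And>n. norm (fps_nth u n) * \<rho> ^ n \<le> C"
    "\<And>t. cmod t \<le> \<rho> \<Longrightarrow> (\<lambda>n. t ^ n *\<^sub>C fps_nth u n) sums f t"
proof -
  obtain r where r: "r > 0" "\<And>t. t \<in> ball 0 r \<Longrightarrow> (\<lambda>n. t ^ n *\<^sub>C fps_nth u n) sums f t"
    using assms by (auto simp: has_sum_near_0_def)
  then have "summable (\<lambda>n. complex_of_real (r/2) ^ n *\<^sub>C fps_nth u n)"
    using r(2)[of "of_real (r/2)"] by (simp add: sums_iff)
  then obtain C where "C > 0" "\<And>n. norm (fps_nth u n) * cmod (of_real (r/2)) ^ n \<le> C"
    using power_series_coeff_bound by blast
  moreover have "cmod (of_real (r/2)) = r/2" using r(1) by (simp only: norm_of_real)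
  ultimately show ?thesis using r by (intro that[of "r/2" C]) auto
qed

text \<open>The disc-sector is kept because the added function is entire and of order 0. The
  constant \<open>C0\<close> is left free since inverting 1 + e n enlarges the bound.\<close>

lemma exp_growth_functions_perturb:
  fixes u v :: "'e::complex_banach fps"
  assumes e: "\<And>n. \<bar>e n\<bar> \<le> C0 * exp (- (real n powr (3/2)))"
    and v: "\<And>n. fps_nth v n = (1 + e n) *\<^sub>R fps_nth u n"
    and k: "k > 0" and f: "f \<in> exp_growth_functions k d \<alpha> r" "has_sum_near_0 u f"
  shows "\<exists>g\<in>exp_growth_functions k d \<alpha> r. has_sum_near_0 v g"
proof -
  obtain \<rho> C where \<rho>: "\<rho> > 0" "\<And>n. norm (fps_nth u n) * \<rho> ^ n \<le> C"
    "\<And>t. cmod t \<le> \<rho> \<Longrightarrow> (\<lambda>n. t ^ n *\<^sub>C fps_nth u n) sums f t"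
    using has_sum_near_0_coeff_bound[OF f(2)] by metis
  let ?E = "\<lambda>t. \<Sum>n. t ^ n *\<^sub>C e n *\<^sub>R fps_nth u n"
  have sums: "(\<lambda>n. t ^ n *\<^sub>C e n *\<^sub>R fps_nth u n) sums ?E t" for t
    using perturbation_entire(1)[OF e \<rho>(2,1) k] by (rule summable_sums)
  obtain M where M: "\<And>t. norm (?E t) \<le> M * exp (cmod t powr k)"
    using perturbation_entire(2)[OF e \<rho>(2,1) k] by blast
  have hol: "?E vholomorphic_on disc_sector d \<alpha> r"
  proof (rule vholomorphic_on_open_cover)
    fix z :: complex
    show "\<exists>T g. open T \<and> z \<in> T \<and> g vholomorphic_on T \<and> (\<forall>w\<in>T. ?E w = g w)"
      using power_series_vholomorphic[OF sums, of "cmod z + 1"]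
      by (intro exI[of _ "ball 0 (cmod z + 1)"] exI[of _ ?E]) auto
  qed
  have "(\<lambda>t. f t + ?E t) \<in> exp_growth_functions k d \<alpha> r"
    unfolding exp_growth_functions_def mem_Collect_eq
  proof (intro conjI ballI)
    show "(\<lambda>t. f t + ?E t) vholomorphic_on disc_sector d \<alpha> r"
      using f(1) hol by (intro vholomorphic_on_add) (auto simp: exp_growth_functions_def)
    fix \<alpha>' r' assume *: "\<alpha>' \<in> {0<..<\<alpha>}" "r' \<in> {0<..<r}"
    with f(1) obtain A B where AB: "A > 0" "B > 0"
      "\<And>t. t \<in> disc_sector d \<alpha>' r' \<Longrightarrow> norm (f t) < A * exp (B * cmod t powr k)"
      unfolding exp_growth_functions_def by blast
    have "norm (f t + ?E t) < (A + \<bar>M\<bar>) * exp ((B + 1) * cmod t powr k)"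
      if t: "t \<in> disc_sector d \<alpha>' r'" for t
    proof -
      let ?x = "cmod t powr k"
      have "norm (f t + ?E t) \<le> norm (f t) + norm (?E t)" by (rule norm_triangle_ineq)
      also have "\<dots> < A * exp (B * ?x) + \<bar>M\<bar> * exp ?x"
        by (intro add_less_le_mono AB(3) t order_trans[OF M[of t]] mult_right_mono abs_ge_self) simp
      also have "\<dots> \<le> A * exp ((B + 1) * ?x) + \<bar>M\<bar> * exp ((B + 1) * ?x)"
        using AB by (intro add_mono mult_left_mono) (auto simp: algebra_simps)
      finally show ?thesis by (simp add: distrib_right)
    qed
    moreover have "A + \<bar>M\<bar> > 0" "B + 1 > 0" using AB by auto
    ultimately show "\<exists>A>0. \<exists>B>0. \<forall>t\<in>disc_sector d \<alpha>' r'. norm (f t + ?E t) < A * exp (B * cmod t powr k)"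
      by blast
  qed
  moreover have "has_sum_near_0 v (\<lambda>t. f t + ?E t)"
    unfolding has_sum_near_0_def
  proof (intro exI[of _ \<rho>] conjI ballI)
    fix t assume "t \<in> ball (0::complex) \<rho>"
    then have "(\<lambda>n. t ^ n *\<^sub>C fps_nth u n) sums f t" by (intro \<rho>(3)) auto
    from sums_add[OF this sums]
    show "(\<lambda>n. t ^ n *\<^sub>C fps_nth v n) sums (f t + ?E t)"
      by (simp add: v scaleC_add_right scaleR_add_left)
  qed (rule \<rho>(1))
  ultimately show ?thesis by blast
qed

text \<open>The Gamma-Borel map acts coefficientwise, so it commutes with multiplication by 1 + e n
  and the question reduces to convergent series.\<close>

lemma summable_in_direction_perturb:
  fixes u v :: "'e::complex_banach fps"
  assumes "\<And>n. \<bar>e n\<bar> \<le> C0 * exp (- (real n powr (3/2)))"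
    and v: "\<And>n. fps_nth v n = (1 + e n) *\<^sub>R fps_nth u n"
    and "k > 0" and u: "summable_in_direction k d u"
  shows "summable_in_direction k d v"
proof -
  let ?B = "borel_map (\<lambda>n. Gamma (1 + real n / k))"
  have v': "fps_nth (?B v) n = (1 + e n) *\<^sub>R fps_nth (?B u) n" for n
    by (simp add: borel_map_def v mult.commute)
  from u show ?thesis
    using exp_growth_functions_perturb[OF assms(1) v' \<open>k > 0\<close>]
    unfolding summable_in_direction_def by blast
qed

text \<open>The converse is again a perturbation: 1 / (1 + e n) = 1 - e n / (1 + e n), with bound
  doubled because 1 + e n >= 1/2. At n = 0 the bound is 1 and would admit a zero denominator, which
  \<open>e 0 = 0\<close> excludes.\<close>

lemma preserves_summability_perturbation:
  assumes e: "\<And>n. \<bar>e n\<bar> \<le> exp (- (real n powr (3/2)))" "e 0 = 0"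
  shows "preserves_summability TYPE('e::complex_banach) (\<lambda>n. 1 / (1 + e n))"
  unfolding preserves_summability_def
proof (intro allI impI iffI)
  let ?m = "\<lambda>n. 1 / (1 + e n)"
  have half: "\<bar>e n\<bar> \<le> 1/2" for n
  proof (cases "n = 0")
    case False
    then have "real n powr (3/2) \<ge> 1" by (simp add: ge_one_powr_ge_zero)
    then have "exp (- (real n powr (3/2))) \<le> exp (-1)" by simp
    also have "exp (-1) \<le> 1 / (2::real)"
      using exp_ge_add_one_self[of 1] by (simp add: exp_minus field_simps)
    finally show ?thesis using e(1)[of n] by linarith
  qed (simp add: e)
  then have pos: "1 + e n \<ge> 1/2" for n using half[of n] by linarith
  fix k d :: real and u :: "'e fps" assume k: "k > 0"
  show "summable_in_direction k d (borel_map ?m u)" if "summable_in_direction k d u"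
    by (rule summable_in_direction_perturb[of e 1, OF _ _ k that]) (use e in \<open>auto simp: borel_map_def\<close>)
  show "summable_in_direction k d u" if "summable_in_direction k d (borel_map ?m u)"
  proof (rule summable_in_direction_perturb[of "\<lambda>n. - e n / (1 + e n)" 2, OF _ _ k that])
    fix n
    have "\<bar>- e n / (1 + e n)\<bar> = \<bar>e n\<bar> / (1 + e n)" using pos[of n] by (simp add: abs_divide)
    also have "\<dots> \<le> \<bar>e n\<bar> / (1/2)" using pos[of n] by (intro divide_left_mono) auto
    finally show "\<bar>- e n / (1 + e n)\<bar> \<le> 2 * exp (- (real n powr (3/2)))" using e(1)[of n] by simp
    have "1 + - e n / (1 + e n) = inverse (1 + e n)" using pos[of n] by (simp add: field_simps)
    moreover have "1 + e n \<noteq> 0" using pos[of n] by linarith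
    ultimately show "fps_nth u n = (1 + - e n / (1 + e n)) *\<^sub>R fps_nth (borel_map ?m u) n"
      by (simp add: borel_map_def)
  qed
qed

section \<open>The geometric series and its perturbation on the negative axis\<close>

lemma vholomorphic_on_geometric:
  "1 \<notin> S \<Longrightarrow> (\<lambda>t. inverse (1 - t) *\<^sub>C (x::'e::complex_banach)) vholomorphic_on S"
  by (intro holomorphic_imp_vholomorphic_scaleC holomorphic_intros) auto

lemma geometric_sums_scaleC:
  assumes "cmod t < 1" shows "(\<lambda>n. t ^ n *\<^sub>C (x::'e::complex_banach)) sums (inverse (1 - t) *\<^sub>C x)"
  using bounded_linear.sums[OF scaleC.bounded_linear_left geometric_sums[OF assms]]
  by (simp add: inverse_eq_divide)

text \<open>A sector away from the positive axis keeps a positive distance from the pole 1. The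
  function is bounded there, and a bounded function has q-exponential growth because the exponential
  factor is at least 1.\<close>

lemma q_extends_in_direction_geometric:
  fixes x :: "'e::complex_banach"
  assumes q: "q > 1" and s: "s > 0" and \<theta>: "0 < \<theta>" "\<theta> < 2 * pi"
  shows "q_extends_in_direction q s \<theta> (Abs_fps (\<lambda>n. x))"
proof -
  \<comment> \<open>This is the angle between direction \<open>\<theta>\<close> and the positive
    axis. Using it as the full opening leaves an angle of \<open>\<alpha>/2\<close> between the
    sector and the axis.\<close>
  define \<alpha> where "\<alpha> = min \<theta> (2 * pi - \<theta>)"
  have \<alpha>: "0 < \<alpha>" "\<alpha> \<le> pi" "\<alpha> \<le> \<theta>" "\<theta> \<le> 2 * pi - \<alpha>" using \<theta> by (auto simp: \<alpha>_def)
  have sin: "sin (\<alpha>/2) > 0" using \<alpha> by (intro sin_gt_zero) auto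
  have far: "sin (\<alpha>/2) \<le> cmod (1 - t)" if "t \<in> sector \<theta> \<alpha>" for t
  proof -
    obtain \<rho> \<phi> where t: "t = of_real \<rho> * cis \<phi>" "\<rho> > 0" "\<theta> - \<alpha>/2 < \<phi>" "\<phi> < \<theta> + \<alpha>/2"
      using \<open>t \<in> sector \<theta> \<alpha>\<close> by (auto simp: sector_def)
    define c where "c = cos (\<alpha>/2)"
    have c: "0 \<le> c" using \<alpha> unfolding c_def by (intro cos_ge_zero) auto
    have "cos \<phi> \<le> c"
    proof (cases "\<phi> \<le> pi")
      case True
      then show ?thesis unfolding c_def using t \<alpha> by (intro cos_monotone_0_pi_le) auto
    next
      case False
      have "cos (2 * pi - \<phi>) \<le> c" unfolding c_def using False t \<alpha> by (intro cos_monotone_0_pi_le) auto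
      then show ?thesis by (simp add: cos_diff)
    qed
    then have "\<rho> * cos \<phi> \<le> \<rho> * c" using t by (intro mult_left_mono) auto
    moreover have "(cmod (1 - t))\<^sup>2 = 1 - 2 * (\<rho> * cos \<phi>) + \<rho>\<^sup>2"
    proof -
      have "(cmod (1 - t))\<^sup>2 = (1 - \<rho> * cos \<phi>)\<^sup>2 + (\<rho> * sin \<phi>)\<^sup>2"
        unfolding t cmod_power2 by simp
      also have "\<dots> = 1 - 2 * (\<rho> * cos \<phi>) + \<rho>\<^sup>2 * ((sin \<phi>)\<^sup>2 + (cos \<phi>)\<^sup>2)" by algebra
      finally show ?thesis by simp
    qed
    \<comment> \<open>Completing the square: the point 1 has distance
      \<open>sin (\<alpha>/2)\<close> from the ray at angle \<open>\<alpha>/2\<close>.\<close>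
    moreover have "1 - 2 * (\<rho> * c) + \<rho>\<^sup>2 = (\<rho> - c)\<^sup>2 + (sin (\<alpha>/2))\<^sup>2"
      using sin_cos_squared_add[of "\<alpha>/2"] by (simp add: c_def power2_eq_square algebra_simps)
    moreover have "(\<rho> - c)\<^sup>2 \<ge> 0" by simp
    ultimately have "(sin (\<alpha>/2))\<^sup>2 \<le> (cmod (1 - t))\<^sup>2" by linarith
    then show ?thesis by (rule power2_le_imp_le) simp
  qed
  let ?f = "\<lambda>t. inverse (1 - t) *\<^sub>C x"
  have "1 \<notin> disc_sector \<theta> \<alpha> 1" using far[of 1] sin by (auto simp: disc_sector_def)
  then have "?f vholomorphic_on disc_sector \<theta> \<alpha> 1" by (rule vholomorphic_on_geometric)
  moreover have "has_sum_near_0 (Abs_fps (\<lambda>n. x)) ?f"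
    unfolding has_sum_near_0_def by (intro exI[of _ 1]) (auto intro: geometric_sums_scaleC)
  moreover have "q_exp_growth q s ?f (sector \<theta> \<alpha>)"
    unfolding q_exp_growth_def
  proof -
    have "norm (?f t) \<le> (norm x / sin (\<alpha>/2) + 1) * exp ((ln (cmod t + 1))\<^sup>2 / (2 * s * ln q)) * (cmod t + 1) powr 0"
      if t: "t \<in> sector \<theta> \<alpha>" for t
    proof -
      let ?X = "exp ((ln (cmod t + 1))\<^sup>2 / (2 * s * ln q))"
      have "norm (?f t) = norm x / cmod (1 - t)" by (simp add: norm_scaleC norm_inverse divide_inverse mult.commute)
      also have "\<dots> \<le> norm x / sin (\<alpha>/2)" using far[OF t] sin by (intro frac_le) auto
      also have "\<dots> \<le> (norm x / sin (\<alpha>/2) + 1) * 1" by simp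
      also have "\<dots> \<le> (norm x / sin (\<alpha>/2) + 1) * ?X" using q s sin by (intro mult_left_mono) auto
      finally show ?thesis using norm_ge_zero[of t] by (simp del: norm_ge_zero)
    qed
    moreover have "norm x / sin (\<alpha>/2) + 1 > 0" using sin by (intro add_nonneg_pos) auto
    ultimately show "\<exists>C>0. \<exists>h>0. \<exists>\<alpha>'. \<forall>t\<in>sector \<theta> \<alpha>.
        norm (?f t) \<le> C * exp ((ln (cmod t + h))\<^sup>2 / (2 * s * ln q)) * (cmod t + h) powr \<alpha>'"
      using zero_less_one by blast
  qed
  ultimately show ?thesis unfolding q_extends_in_direction_def using \<alpha>(1) zero_less_one by blast
qed

lemma negative_mem_sector: "y > 0 \<Longrightarrow> \<alpha> > 0 \<Longrightarrow> - complex_of_real y \<in> sector pi \<alpha>"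
  unfolding sector_def
  by (rule CollectI, rule exI[of _ y], rule exI[of _ pi]) auto

text \<open>At t = - y the signs of e n cancel those of t^n, and the geometric part 1 / (1 + y) is
  positive too. Nothing can cancel, so the norm of the function dominates each single term.\<close>

lemma not_q_extends_in_direction_perturbation:
  fixes x :: "'e::complex_banach"
  assumes q: "q > 1" and x: "x \<noteq> 0"
    and e: "e = (\<lambda>n. if n = 0 then 0 else (-1) ^ n * exp (- (real n powr (3/2))))"
  shows "\<not> q_extends_in_direction q 1 pi (Abs_fps (\<lambda>n. (1 + e n) *\<^sub>R x))"
proof
  assume "q_extends_in_direction q 1 pi (Abs_fps (\<lambda>n. (1 + e n) *\<^sub>R x))"
  then obtain \<beta> r' f where f': "\<beta> > 0" "r' > 0" "f vholomorphic_on disc_sector pi \<beta> r'"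
    "has_sum_near_0 (Abs_fps (\<lambda>n. (1 + e n) *\<^sub>R x)) f" "q_exp_growth q 1 f (sector pi \<beta>)"
    unfolding q_extends_in_direction_def by blast
  \<comment> \<open>With opening at most pi and radius at most 1 the domain omits the pole 1, so f
    can be identified on it with the explicit function. The growth bound is still taken on the
    original sector.\<close>
  define \<alpha> r where "\<alpha> = min \<beta> pi" "r = min r' 1"
  have \<alpha>: "0 < \<alpha>" "\<alpha> \<le> pi" "\<alpha> \<le> \<beta>" "0 < r" "r \<le> 1" "r \<le> r'" using f' by (auto simp: \<alpha>_r_def)
  let ?S = "disc_sector pi \<alpha> r"
  have f: "f vholomorphic_on ?S"
    using f'(3) by (rule vholomorphic_on_subset) (use \<alpha> in \<open>intro disc_sector_mono; auto\<close>)
  let ?E = "\<lambda>t. \<Sum>n. t ^ n *\<^sub>C e n *\<^sub>R x"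
  have e_bound: "\<bar>e n\<bar> \<le> 1 * exp (- (real n powr (3/2)))" for n
    by (simp add: e abs_mult)
  have sums: "(\<lambda>n. t ^ n *\<^sub>C e n *\<^sub>R x) sums ?E t" for t
    using perturbation_entire(1)[of e 1 "\<lambda>_. x" 1 "norm x" 1 t] e_bound by (intro summable_sums) auto
  have E: "?E vholomorphic_on ?S"
  proof (rule vholomorphic_on_open_cover)
    fix z :: complex
    show "\<exists>T g. open T \<and> z \<in> T \<and> g vholomorphic_on T \<and> (\<forall>w\<in>T. ?E w = g w)"
      using power_series_vholomorphic[OF sums, of "cmod z + 1"]
      by (intro exI[of _ "ball 0 (cmod z + 1)"] exI[of _ ?E]) auto
  qed
  have "1 \<notin> ?S"
  proof
    assume "1 \<in> ?S"
    then have "1 \<in> sector pi \<alpha>" using \<alpha> by (auto simp: disc_sector_def)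
    then obtain \<rho> \<phi> where *: "1 = of_real \<rho> * cis \<phi>" "\<rho> > 0" "pi - \<alpha>/2 < \<phi>" "\<phi> < pi + \<alpha>/2"
      by (auto simp: sector_def)
    have "cos \<phi> < 0" using * \<alpha> cos_gt_zero_pi[of "\<phi> - pi"] by (simp add: cos_diff)
    moreover have "1 = \<rho> * cos \<phi>" using arg_cong[OF *(1), of Re] by simp
    ultimately show False using *(2) by (simp add: mult_pos_neg) (smt (verit) mult_pos_neg)
  qed
  then have G: "(\<lambda>t. inverse (1 - t) *\<^sub>C x + ?E t) vholomorphic_on ?S"
    by (intro vholomorphic_on_add vholomorphic_on_geometric E)
  obtain \<rho> where \<rho>: "\<rho> > 0" "\<And>t. t \<in> ball 0 \<rho> \<Longrightarrow> (\<lambda>n. t ^ n *\<^sub>C (1 + e n) *\<^sub>R x) sums f t"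
    using f'(4) by (auto simp: has_sum_near_0_def)
  have eq: "f t = inverse (1 - t) *\<^sub>C x + ?E t" if "t \<in> ?S" for t
  proof (rule vholomorphic_on_unique[OF _ _ _ _ _ f G _ that])
    let ?U = "ball 0 (min \<rho> r)"
    show "open ?U" "?U \<noteq> {}" "?U \<subseteq> ?S" "open ?S" "connected ?S"
      using \<rho>(1) \<alpha> by (simp_all add: open_disc_sector connected_disc_sector)
        (auto simp: disc_sector_def)
    fix z :: complex assume z: "z \<in> ?U"
    have "(\<lambda>n. z ^ n *\<^sub>C x + z ^ n *\<^sub>C e n *\<^sub>R x) sums (inverse (1 - z) *\<^sub>C x + ?E z)"
      using z \<alpha> by (intro sums_add sums geometric_sums_scaleC) auto
    then have "(\<lambda>n. z ^ n *\<^sub>C (1 + e n) *\<^sub>R x) sums (inverse (1 - z) *\<^sub>C x + ?E z)"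
      by (simp add: scaleR_add_left scaleC_add_right)
    then show "f z = inverse (1 - z) *\<^sub>C x + ?E z"
      using \<rho>(2)[of z] z sums_unique2 by auto
  qed
  have lower: "exp (- (real n powr (3/2))) * y ^ n * norm x \<le> norm (f (- of_real y))"
    if "y > 0" "n > 0" for y n
  proof -
    let ?a = "\<lambda>n. y ^ n * (if n = 0 then 0 else exp (- (real n powr (3/2))))"
    have "(- complex_of_real y) ^ n *\<^sub>C e n *\<^sub>R x = ?a n *\<^sub>R x" for n
    proof -
      have "(- complex_of_real y) ^ n *\<^sub>C e n *\<^sub>R x = ((- complex_of_real y) ^ n * of_real (e n)) *\<^sub>C x"
        by (simp add: scaleC_scaleC flip: scaleC_of_real)
      also have "(- complex_of_real y) ^ n * of_real (e n) = of_real ((- y) ^ n * e n)" by simp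
      also have "(- y) ^ n * e n = ?a n"
        by (cases "even n") (simp_all add: e)
      finally show ?thesis by (simp only: scaleC_of_real)
    qed
    then have a_sums: "(\<lambda>n. ?a n *\<^sub>R x) sums ?E (- of_real y)" using sums[of "- of_real y"] by simp
    \<comment> \<open>A functional that does not vanish at x carries convergence of the vector
      series over to its real coefficients.\<close>
    obtain \<phi> where \<phi>: "\<phi> \<in> functionals" "norm x \<le> cmod (\<phi> x)" by (rule norming_functional)
    interpret bounded_linear \<phi> by (rule functionals_bounded_linear[OF \<phi>(1)])
    have "\<phi> x \<noteq> 0" using \<phi>(2) x by auto
    moreover have "summable (\<lambda>n. complex_of_real (?a n) * \<phi> x)"
      using sums_summable[OF sums[OF a_sums]] by (simp only: scaleR scaleR_conv_of_real)
    ultimately have "summable (\<lambda>n. complex_of_real (?a n))"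
      using summable_mult2[of "\<lambda>n. complex_of_real (?a n) * \<phi> x" "inverse (\<phi> x)"]
      by (simp add: mult.assoc)
    then have a: "summable ?a" by (simp only: summable_of_real_iff)
    have "?E (- of_real y) = suminf ?a *\<^sub>R x"
      using sums_unique2[OF a_sums] sums_scaleR_left[OF summable_sums[OF a], of x] by blast
    moreover have "inverse (1 - - complex_of_real y) *\<^sub>C x = inverse (1 + y) *\<^sub>R x"
    proof -
      have "inverse (1 - - complex_of_real y) = of_real (inverse (1 + y))" by simp
      then show ?thesis by (simp only: scaleC_of_real)
    qed
    moreover have "- complex_of_real y \<in> ?S"
      using negative_mem_sector[OF that(1) \<alpha>(1)] by (simp add: disc_sector_def)
    ultimately have "f (- of_real y) = (inverse (1 + y) + suminf ?a) *\<^sub>R x"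
      using eq by (simp add: scaleR_add_left)
    moreover have "?a n \<le> suminf ?a"
      using sum_le_suminf[OF a, of "{n}"] that by simp
    moreover have "inverse (1 + y) > 0" using that by simp
    ultimately have f_eq: "f (- of_real y) = (inverse (1 + y) + suminf ?a) *\<^sub>R x"
      and le: "?a n \<le> suminf ?a" and pos: "inverse (1 + y) > 0" by blast+
    from le pos have "?a n \<le> \<bar>inverse (1 + y) + suminf ?a\<bar>" by linarith
    then have "?a n * norm x \<le> norm (f (- of_real y))"
      unfolding f_eq norm_scaleR by (intro mult_right_mono) auto
    then show ?thesis using that by (simp add: mult.commute[of "exp _"])
  qed
  obtain C h a where C: "C > 0" "h > 0"
    "\<And>t. t \<in> sector pi \<beta> \<Longrightarrow> norm (f t) \<le> C * exp ((ln (cmod t + h))\<^sup>2 / (2 * 1 * ln q)) * (cmod t + h) powr a"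
    using f'(5) unfolding q_exp_growth_def by blast
  define K where "K = 1 / (2 * ln q)"
  have K: "K > 0" using q by (simp add: K_def)
  \<comment> \<open>At log y = 2 sqrt n the n-th term is exp (- n^(3/2) + 2 n^(3/2)) = exp
    (n^(3/2)), whereas the growth bound allows only an exponent of order n.\<close>
  define y where "y n = exp (2 * sqrt (real n))" for n
  have y: "y n > 0" for n by (simp add: y_def)
  have upper: "norm (f (- of_real (y n))) \<le> C * exp (K * (ln (y n + h))\<^sup>2 + a * ln (y n + h))" for n
  proof -
    have "y n + h \<noteq> 0" using y[of n] C(2) by simp
    then show ?thesis
      using C(3)[OF negative_mem_sector[OF y[of n] f'(1)]] y[of n] by (simp add: K_def powr_def exp_add)
  qed
  have "filterlim (\<lambda>n. - (real n powr (3/2)) + 2 * sqrt (real n) * real n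
      - (K * (ln (exp (2 * sqrt (real n)) + h))\<^sup>2 + a * ln (exp (2 * sqrt (real n)) + h))) at_top sequentially"
    using K C(2) by real_asymp
  then have "\<forall>\<^sub>F n in sequentially. ln (C / norm x) < - (real n powr (3/2)) + 2 * sqrt (real n) * real n
      - (K * (ln (y n + h))\<^sup>2 + a * ln (y n + h))"
    unfolding y_def filterlim_at_top_dense by blast
  with eventually_gt_at_top[of 0] have "\<forall>\<^sub>F n in sequentially. False"
  proof eventually_elim
    case (elim n)
    let ?X = "- (real n powr (3/2)) + 2 * sqrt (real n) * real n"
    let ?Y = "K * (ln (y n + h))\<^sup>2 + a * ln (y n + h)"
    have "exp ?X = exp (- (real n powr (3/2))) * y n ^ n"
      unfolding y_def exp_add by (simp add: mult.commute flip: exp_of_nat_mult)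
    then have "exp ?X * norm x \<le> C * exp ?Y"
      using lower[OF y, of n n] upper[of n] elim by simp
    moreover have "exp (X - Y) \<le> C / N" if "exp X * N \<le> C * exp Y" "N > 0" for X Y N :: real
      using that by (simp add: exp_diff field_simps)
    ultimately have "exp (?X - ?Y) \<le> C / norm x" using x by simp
    moreover have "C / norm x = exp (ln (C / norm x))" using x C(1) by simp
    ultimately have "?X - ?Y \<le> ln (C / norm x)" by (metis exp_le_cancel_iff)
    with elim show False by simp
  qed
  then show False by simp
qed

section \<open>Multiplying coefficients by a contour integral\<close>

text \<open>In the coordinate \<open>\<zeta> = log w\<close> the measure \<open>dw / w\<close> becomes \<open>d\<zeta>\<close>, and \<open>G\<close> plays the role
  of \<open>g \<circ> exp\<close>.\<close>

definition hadamard_segment ::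
    "(complex \<Rightarrow> complex) \<Rightarrow> (complex \<Rightarrow> 'e::complex_banach) \<Rightarrow> complex \<Rightarrow> complex \<Rightarrow> complex \<Rightarrow> 'e" where
  "hadamard_segment G f p q t =
     (q - p) *\<^sub>C integral {0..1} (\<lambda>x. G (linepath p q x) *\<^sub>C f (t * exp (- linepath p q x)))"

lemma linepath_in_segment: "x \<in> {0..1} \<Longrightarrow> linepath p q x \<in> closed_segment p q"
  by (simp add: linepath_in_path)

context
  fixes G :: "complex \<Rightarrow> complex" and f :: "complex \<Rightarrow> 'e::complex_banach" and \<Omega> and p q :: complex
  assumes G: "continuous_on (closed_segment p q) G" and f: "f vholomorphic_on \<Omega>" and \<Omega>: "open \<Omega>"
begin

lemma continuous_on_hadamard_integrand:
  assumes "\<And>\<zeta>. \<zeta> \<in> closed_segment p q \<Longrightarrow> t * exp (- \<zeta>) \<in> \<Omega>"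
  shows "continuous_on {0..1} (\<lambda>x. G (linepath p q x) *\<^sub>C f (t * exp (- linepath p q x)))"
proof (intro scaleC.continuous_on)
  show "continuous_on {0..1} (\<lambda>x. G (linepath p q x))"
    by (rule continuous_on_compose2[OF G continuous_on_linepath]) (auto simp: linepath_in_segment)
  show "continuous_on {0..1} (\<lambda>x. f (t * exp (- linepath p q x)))"
    by (rule continuous_on_compose2[OF vholomorphic_on_imp_continuous_on[OF f]])
      (auto intro!: continuous_intros continuous_on_linepath assms linepath_in_segment)
qed

text \<open>Bounded linear maps commute with the integral. Expansion in series and deformation of
  paths can thus be carried out on complex-valued contour integrals.\<close>

lemma functional_hadamard_segment:
  assumes "\<And>\<zeta>. \<zeta> \<in> closed_segment p q \<Longrightarrow> t * exp (- \<zeta>) \<in> \<Omega>" and \<phi>: "\<phi> \<in> functionals"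
  shows "\<phi> (hadamard_segment G f p q t) =
    contour_integral (linepath p q) (\<lambda>\<zeta>. G \<zeta> * \<phi> (f (t * exp (- \<zeta>))))"
proof -
  let ?h = "\<lambda>x. G (linepath p q x) *\<^sub>C f (t * exp (- linepath p q x))"
  have "?h integrable_on {0..1}"
    using continuous_on_hadamard_integrand[OF assms(1)] by (rule integrable_continuous_real)
  from integral_linear[OF this functionals_bounded_linear[OF \<phi>]]
  have "\<phi> (integral {0..1} ?h) = integral {0..1} (\<lambda>x. \<phi> (?h x))" by (simp add: o_def)
  then show ?thesis
    by (simp add: hadamard_segment_def functionals_scaleC[OF \<phi>] contour_integral_integral
        mult.commute[of _ "q - p"])
qed

lemma norm_hadamard_segment_le:
  assumes "\<And>\<zeta>. \<zeta> \<in> closed_segment p q \<Longrightarrow> t * exp (- \<zeta>) \<in> \<Omega>"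
    and "\<And>\<zeta>. \<zeta> \<in> closed_segment p q \<Longrightarrow> cmod (G \<zeta>) \<le> A"
    and "\<And>\<zeta>. \<zeta> \<in> closed_segment p q \<Longrightarrow> norm (f (t * exp (- \<zeta>))) \<le> B"
  shows "norm (hadamard_segment G f p q t) \<le> cmod (q - p) * (A * B)"
proof -
  have "A \<ge> 0" using order_trans[OF norm_ge_zero assms(2)[of p]] by simp
  have "norm (integral {0..1} (\<lambda>x. G (linepath p q x) *\<^sub>C f (t * exp (- linepath p q x)))) \<le> A * B * (1 - 0)"
    using \<open>A \<ge> 0\<close> assms(2,3)
    by (intro integral_bound continuous_on_hadamard_integrand assms(1))
      (auto simp: norm_scaleC linepath_in_segment intro!: mult_mono)
  then show ?thesis by (simp add: hadamard_segment_def norm_scaleC mult_left_mono)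
qed

lemma vholomorphic_on_hadamard_segment:
  assumes "open T" and T: "\<And>t \<zeta>. t \<in> T \<Longrightarrow> \<zeta> \<in> closed_segment p q \<Longrightarrow> t * exp (- \<zeta>) \<in> \<Omega>"
  shows "hadamard_segment G f p q vholomorphic_on T"
proof (rule weakly_holomorphic_imp_vholomorphic)
  fix \<phi> :: "'e \<Rightarrow> complex" assume \<phi>: "\<phi> \<in> functionals"
  let ?g = "\<lambda>z. \<phi> (f z)"
  have g: "?g holomorphic_on \<Omega>" using f \<phi> by (rule holomorphic_on_functional)
  let ?H = "\<lambda>t x. (q - p) * (G (linepath p q x) * ?g (t * exp (- linepath p q x)))"
  let ?H' = "\<lambda>t x. (q - p) * (G (linepath p q x) * (deriv ?g (t * exp (- linepath p q x)) * exp (- linepath p q x)))"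
  \<comment> \<open>Differentiation under the integral sign is applied on balls, which are convex;
    analyticity, being local, then covers all of T.\<close>
  have "(\<lambda>t. \<phi> (hadamard_segment G f p q t)) holomorphic_on ball t0 e" if "ball t0 e \<subseteq> T" for t0 e
  proof -
    have "(\<lambda>t. integral (cbox 0 1) (?H t)) holomorphic_on ball t0 e"
    proof (rule leibniz_rule_holomorphic[where fx = ?H'])
      fix t and x :: real assume "t \<in> ball t0 e" "x \<in> cbox 0 1"
      then have "t * exp (- linepath p q x) \<in> \<Omega>"
        using that by (intro T) (auto simp: linepath_in_segment)
      then have "(?g has_field_derivative deriv ?g (t * exp (- linepath p q x))) (at (t * exp (- linepath p q x)))"
        by (rule holomorphic_derivI[OF g \<Omega>])
      then show "((\<lambda>t. ?H t x) has_field_derivative ?H' t x) (at t within ball t0 e)"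
        by (auto intro!: DERIV_cmult DERIV_chain2[of ?g] derivative_eq_intros)
    next
      fix t assume "t \<in> ball t0 e"
      then have "continuous_on {0..1} (\<lambda>x. \<phi> (G (linepath p q x) *\<^sub>C f (t * exp (- linepath p q x))))"
        using that T by (intro bounded_linear.continuous_on[OF functionals_bounded_linear[OF \<phi>]]
            continuous_on_hadamard_integrand) auto
      then show "?H t integrable_on cbox 0 1"
        by (auto simp: functionals_scaleC[OF \<phi>] intro!: integrable_continuous_real continuous_intros)
    next
      have "continuous_on \<Omega> (deriv ?g)"
        using holomorphic_deriv[OF g \<Omega>] by (rule holomorphic_on_imp_continuous_on)
      then have "continuous_on (ball t0 e \<times> {0..1}) (\<lambda>x. deriv ?g (fst x * exp (- linepath p q (snd x))))"
        by (rule continuous_on_compose2)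
          (use that in \<open>auto intro!: continuous_intros continuous_on_compose2[OF continuous_on_linepath[of UNIV]] T linepath_in_segment\<close>)
      moreover have "continuous_on (ball t0 e \<times> {0..1}) (\<lambda>x. G (linepath p q (snd x)))"
        by (rule continuous_on_compose2[OF G])
          (auto intro!: continuous_on_compose2[OF continuous_on_linepath[of UNIV]] continuous_intros linepath_in_segment)
      moreover have "continuous_on (ball t0 e \<times> {0..1}) (\<lambda>x. exp (- linepath p q (snd x)))"
        by (auto intro!: continuous_on_compose2[OF continuous_on_linepath[of UNIV]] continuous_intros)
      ultimately show "continuous_on (ball t0 e \<times> cbox 0 1) (\<lambda>(t, x). ?H' t x)"
        by (simp add: case_prod_beta continuous_intros)
    qed simp
    moreover have "integral (cbox 0 1) (?H t) = \<phi> (hadamard_segment G f p q t)" if "t \<in> ball t0 e" for t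
      using that \<open>ball t0 e \<subseteq> T\<close> T
      by (subst functional_hadamard_segment[OF _ \<phi>]) (auto simp: contour_integral_integral mult.commute)
    ultimately show ?thesis by (rule holomorphic_transform)
  qed
  then have "(\<lambda>t. \<phi> (hadamard_segment G f p q t)) analytic_on T"
    unfolding analytic_on_def using \<open>open T\<close> by (meson open_contains_ball)
  then show "(\<lambda>t. \<phi> (hadamard_segment G f p q t)) holomorphic_on T"
    by (rule analytic_imp_holomorphic)
next
  fix t0 assume "t0 \<in> T"
  then obtain e where e: "e > 0" "cball t0 e \<subseteq> T" using \<open>open T\<close> open_contains_cball by blast
  \<comment> \<open>Compactness of this set of arguments bounds f on it, which gives the local
    boundedness that weak holomorphy has to be combined with.\<close>
  let ?K = "(\<lambda>(t, \<zeta>). t * exp (- \<zeta>)) ` (cball t0 e \<times> closed_segment p q)"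
  have "compact ?K"
    by (intro compact_continuous_image compact_Times) (auto simp: case_prod_beta intro!: continuous_intros)
  moreover have "?K \<subseteq> \<Omega>" using e T by auto
  ultimately have "compact (f ` ?K)"
    using vholomorphic_on_imp_continuous_on[OF f] by (meson compact_continuous_image continuous_on_subset)
  then obtain B where "\<And>x. x \<in> f ` ?K \<Longrightarrow> norm x \<le> B"
    using compact_imp_bounded bounded_pos by metis
  then have B: "norm (f (t * exp (- \<zeta>))) \<le> B" if "t \<in> cball t0 e" "\<zeta> \<in> closed_segment p q" for t \<zeta>
    using that by force
  have "compact (G ` closed_segment p q)" using G by (intro compact_continuous_image) auto
  then obtain A where A: "\<And>x. x \<in> G ` closed_segment p q \<Longrightarrow> norm x \<le> A"
    using compact_imp_bounded bounded_pos by metis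
  have "norm (hadamard_segment G f p q t) \<le> cmod (q - p) * (A * B)" if "t \<in> ball t0 e" for t
    using that e A by (intro norm_hadamard_segment_le B T) auto
  then show "\<exists>R>0. \<exists>M. ball t0 R \<subseteq> T \<and> (\<forall>w\<in>ball t0 R. norm (hadamard_segment G f p q w) \<le> M)"
    using e ball_subset_cball by blast
qed

end

section \<open>Coefficientwise products as integrals over a full circle\<close>

lemma contour_integral_linepath_sums:
  assumes cont: "\<And>k. continuous_on (closed_segment p q) (\<psi> k)"
    and M: "\<And>k \<zeta>. \<zeta> \<in> closed_segment p q \<Longrightarrow> cmod (\<psi> k \<zeta>) \<le> M k" "summable M"
    and S: "\<And>\<zeta>. \<zeta> \<in> closed_segment p q \<Longrightarrow> (\<lambda>k. \<psi> k \<zeta>) sums S \<zeta>"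
  shows "(\<lambda>k. contour_integral (linepath p q) (\<psi> k)) sums contour_integral (linepath p q) S"
proof -
  have int: "\<psi> k contour_integrable_on linepath p q" for k
    using cont by (rule contour_integrable_continuous_linepath)
  have "uniform_limit (closed_segment p q) (\<lambda>n \<zeta>. \<Sum>k<n. \<psi> k \<zeta>) (\<lambda>\<zeta>. suminf (\<lambda>k. \<psi> k \<zeta>)) sequentially"
    using M by (intro Weierstrass_m_test)
  then have "uniform_limit (closed_segment p q) (\<lambda>n \<zeta>. \<Sum>k<n. \<psi> k \<zeta>) S sequentially"
    by (rule uniform_limit_cong'[THEN iffD1, rotated 2]) (use S in \<open>auto simp: sums_iff\<close>)
  then have "((\<lambda>n. contour_integral (linepath p q) (\<lambda>\<zeta>. \<Sum>k<n. \<psi> k \<zeta>)) \<longlongrightarrow> contour_integral (linepath p q) S) sequentially"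
    by (intro contour_integral_uniform_limit[where B = "cmod (q - p)"]) (auto intro!: eventuallyI contour_integrable_sum int)
  then show ?thesis unfolding sums_def by (simp add: contour_integral_sum int)
qed

text \<open>Orthogonality of the monomials w^j on a circle, in the coordinate log w: for j distinct
  from 0 the primitive takes equal values at both ends.\<close>

lemma contour_integral_exp_period:
  "contour_integral (linepath a (a + 2 * pi * \<i>)) (\<lambda>\<zeta>. exp (of_int j * \<zeta>)) = (if j = 0 then 2 * pi * \<i> else 0)"
proof (cases "j = 0")
  case False
  then have "((\<lambda>\<zeta>. exp (of_int j * \<zeta>) / of_int j) has_field_derivative exp (of_int j * x)) (at x within UNIV)"
    for x :: complex
    by (auto intro!: derivative_eq_intros)
  then have "((\<lambda>\<zeta>. exp (of_int j * \<zeta>)) has_contour_integral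
      (exp (of_int j * (a + 2 * pi * \<i>)) / of_int j - exp (of_int j * a) / of_int j)) (linepath a (a + 2 * pi * \<i>))"
    using contour_integral_primitive[of UNIV "\<lambda>\<zeta>. exp (of_int j * \<zeta>) / of_int j"
        "\<lambda>\<zeta>. exp (of_int j * \<zeta>)" "linepath a (a + 2 * pi * \<i>)"] by simp
  moreover have "exp (of_int j * (a + 2 * pi * \<i>)) = exp (of_int j * a)"
    unfolding exp_eq by (intro exI[of _ j]) (simp add: algebra_simps)
  ultimately show ?thesis using False contour_integral_unique by fastforce
qed (simp add: contour_integral_const_linepath)

text \<open>The radius exp (Re a) of the circle must lie inside the disc of convergence of the
  series with coefficients c, yet be large enough for t / w to lie in that of h. Both series may
  then be integrated termwise.\<close>

lemma contour_integral_linepath_hadamard: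
  fixes a t :: complex
  assumes c: "\<And>n. cmod (c n) * s ^ n \<le> C" "exp (Re a) < s"
    and h: "\<And>n. cmod (h n) * r ^ n \<le> C'" "cmod t * exp (- Re a) < r"
    and G: "\<And>\<zeta>. Re \<zeta> = Re a \<Longrightarrow> (\<lambda>n. c n * exp \<zeta> ^ n) sums G \<zeta>"
    and H: "\<And>w. cmod w < r \<Longrightarrow> (\<lambda>n. h n * w ^ n) sums H w"
    and cont: "continuous_on (closed_segment a (a + 2 * pi * \<i>)) G"
  shows "(\<lambda>n. 2 * pi * \<i> * (c n * h n * t ^ n)) sums
    contour_integral (linepath a (a + 2 * pi * \<i>)) (\<lambda>\<zeta>. G \<zeta> * H (t * exp (- \<zeta>)))"
proof -
  let ?b = "a + 2 * pi * \<i>"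
  let ?S = "closed_segment a ?b"
  have s: "s > 0" using c(2) exp_gt_zero[of "Re a"] by linarith
  have r: "r > 0" using h(2) by (smt (verit) exp_ge_zero mult_nonneg_nonneg norm_ge_zero)
  have Re: "Re \<zeta> = Re a" if "\<zeta> \<in> ?S" for \<zeta>
    using that by (auto simp: in_segment algebra_simps)
  \<comment> \<open>Coefficient extraction: the factor exp (- n \<zeta>) singles out c n from the
    expansion of G.\<close>
  have inner: "contour_integral (linepath a ?b) (\<lambda>\<zeta>. G \<zeta> * exp (- \<zeta>) ^ n) = 2 * pi * \<i> * c n" for n
  proof -
    let ?\<psi> = "\<lambda>k \<zeta>. c k * exp (of_int (int k - int n) * \<zeta>)"
    have eq: "?\<psi> k \<zeta> = (c k * exp \<zeta> ^ k) * exp (- \<zeta>) ^ n" for k \<zeta>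
      by (simp add: left_diff_distrib exp_diff exp_of_nat_mult exp_minus power_inverse divide_inverse)
    have "(\<lambda>k. contour_integral (linepath a ?b) (?\<psi> k)) sums
        contour_integral (linepath a ?b) (\<lambda>\<zeta>. G \<zeta> * exp (- \<zeta>) ^ n)"
    proof (rule contour_integral_linepath_sums)
      show "continuous_on ?S (?\<psi> k)" for k by (intro continuous_intros)
      show "summable (\<lambda>k. C * (exp (Re a) / s) ^ k * exp (- Re a) ^ n)"
        using c(2) s by (intro summable_mult summable_mult2 summable_geometric) auto
      show "cmod (?\<psi> k \<zeta>) \<le> C * (exp (Re a) / s) ^ k * exp (- Re a) ^ n" if "\<zeta> \<in> ?S" for k \<zeta>
      proof -
        have "cmod (?\<psi> k \<zeta>) = cmod (c k) * exp (Re a) ^ k * exp (- Re a) ^ n"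
          unfolding eq by (simp add: norm_mult norm_power Re[OF that])
        also have "cmod (c k) * exp (Re a) ^ k = cmod (c k) * s ^ k * (exp (Re a) / s) ^ k"
          using s by (simp add: power_divide)
        also have "\<dots> * exp (- Re a) ^ n \<le> C * (exp (Re a) / s) ^ k * exp (- Re a) ^ n"
          using s by (intro mult_right_mono c) auto
        finally show ?thesis .
      qed
      show "(\<lambda>k. ?\<psi> k \<zeta>) sums (G \<zeta> * exp (- \<zeta>) ^ n)" if "\<zeta> \<in> ?S" for \<zeta>
        unfolding eq using that by (intro sums_mult2 G Re)
    qed
    moreover have "contour_integral (linepath a ?b) (?\<psi> k) = (if k = n then 2 * pi * \<i> * c n else 0)" for k
      using contour_integral_exp_period[of a "int k - int n"]
      by (subst contour_integral_lmul)
        (auto intro!: contour_integrable_continuous_linepath continuous_intros)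
    ultimately show ?thesis
      using sums_single[of n "\<lambda>_. 2 * pi * \<i> * c n"] sums_unique2 by fastforce
  qed
  have "compact (G ` ?S)" using cont by (intro compact_continuous_image) auto
  then obtain A where A: "\<And>\<zeta>. \<zeta> \<in> ?S \<Longrightarrow> cmod (G \<zeta>) \<le> A"
    using compact_imp_bounded bounded_pos by (metis image_eqI)
  then have "A \<ge> 0" using order_trans[OF norm_ge_zero] by blast
  have C': "C' \<ge> 0" using order_trans[OF norm_ge_zero, of "h 0" C'] h(1)[of 0] by simp
  let ?x = "cmod t * exp (- Re a)"
  have "(\<lambda>n. contour_integral (linepath a ?b) (\<lambda>\<zeta>. G \<zeta> * (h n * (t * exp (- \<zeta>)) ^ n))) sums
      contour_integral (linepath a ?b) (\<lambda>\<zeta>. G \<zeta> * H (t * exp (- \<zeta>)))"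
  proof (rule contour_integral_linepath_sums)
    show "continuous_on ?S (\<lambda>\<zeta>. G \<zeta> * (h n * (t * exp (- \<zeta>)) ^ n))" for n by (intro continuous_intros cont)
    show "summable (\<lambda>n. A * (C' * (?x / r) ^ n))"
      using h(2) r by (intro summable_mult summable_geometric) auto
    fix \<zeta> assume \<zeta>: "\<zeta> \<in> ?S"
    have norm: "cmod (t * exp (- \<zeta>)) = ?x" by (simp add: norm_mult Re[OF \<zeta>])
    show "(\<lambda>n. G \<zeta> * (h n * (t * exp (- \<zeta>)) ^ n)) sums (G \<zeta> * H (t * exp (- \<zeta>)))"
      using h(2) norm by (intro sums_mult H) simp
    fix n
    have "cmod (h n * (t * exp (- \<zeta>)) ^ n) = cmod (h n) * r ^ n * (?x / r) ^ n"
      using r by (simp only: norm_mult norm_power norm[unfolded norm_mult] power_divide) simp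
    also have "\<dots> \<le> C' * (?x / r) ^ n" using r by (intro mult_right_mono h) auto
    finally show "cmod (G \<zeta> * (h n * (t * exp (- \<zeta>)) ^ n)) \<le> A * (C' * (?x / r) ^ n)"
      unfolding norm_mult[of "G \<zeta>"] using \<open>A \<ge> 0\<close> by (intro mult_mono A \<zeta>) auto
  qed
  moreover have "contour_integral (linepath a ?b) (\<lambda>\<zeta>. G \<zeta> * (h n * (t * exp (- \<zeta>)) ^ n)) =
      2 * pi * \<i> * (c n * h n * t ^ n)" for n
  proof -
    have "contour_integral (linepath a ?b) (\<lambda>\<zeta>. G \<zeta> * (h n * (t * exp (- \<zeta>)) ^ n)) =
        contour_integral (linepath a ?b) (\<lambda>\<zeta>. (h n * t ^ n) * (G \<zeta> * exp (- \<zeta>) ^ n))"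
      by (simp add: power_mult_distrib mult_ac)
    also have "\<dots> = (h n * t ^ n) * contour_integral (linepath a ?b) (\<lambda>\<zeta>. G \<zeta> * exp (- \<zeta>) ^ n)"
      by (intro contour_integral_lmul contour_integrable_continuous_linepath continuous_intros cont)
    finally show ?thesis unfolding inner by simp
  qed
  ultimately show ?thesis by simp
qed

section \<open>Kernels and contours around the positive axis\<close>

lemma holomorphic_convex_linepath_primitive:
  assumes "convex S" "open S" "\<psi> holomorphic_on S"
  obtains P where "\<And>p q. p \<in> S \<Longrightarrow> q \<in> S \<Longrightarrow> contour_integral (linepath p q) \<psi> = P q - P p"
proof -
  obtain P where P: "\<And>x. x \<in> S \<Longrightarrow> (P has_field_derivative \<psi> x) (at x within S)"
    using holomorphic_convex_primitive'[OF assms(1,2,3)] by blast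
  have "contour_integral (linepath p q) \<psi> = P q - P p" if "p \<in> S" "q \<in> S" for p q
    using contour_integral_primitive[OF P valid_path_linepath[of p q]] that assms(1)
      closed_segment_subset[of p S q] by (intro contour_integral_unique) auto
  then show ?thesis using that by blast
qed

text \<open>G stands for g o exp, where g is the series with coefficients c. The strip is the plane
  slit along the positive axis, the half-plane is a punctured disc about 0, and exp (k Re \<zeta>)
  is |w|^k. The constants may depend on \<epsilon>, as nothing is known near the axis outside the
  disc.\<close>

definition summability_kernel :: "(nat \<Rightarrow> real) \<Rightarrow> (complex \<Rightarrow> complex) \<Rightarrow> real \<Rightarrow> bool" where
  "summability_kernel c G x0 \<longleftrightarrow>
     G holomorphic_on ({\<zeta>. 0 < Im \<zeta> \<and> Im \<zeta> < 2 * pi} \<union> {\<zeta>. Re \<zeta> < x0}) \<and>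
     (\<forall>\<zeta>. Re \<zeta> < x0 \<longrightarrow> (\<lambda>n. of_real (c n) * exp \<zeta> ^ n) sums G \<zeta>) \<and>
     (\<forall>k>0. \<forall>\<epsilon>>0. \<exists>A B. \<forall>\<zeta>. \<epsilon> \<le> Im \<zeta> \<and> Im \<zeta> \<le> 2 * pi - \<epsilon> \<longrightarrow>
        cmod (G \<zeta>) \<le> A * exp (B * exp (k * Re \<zeta>)))"

lemma vholomorphic_on_scaleC_left:
  assumes "f vholomorphic_on S" shows "(\<lambda>z. c *\<^sub>C f z) vholomorphic_on S"
  unfolding vholomorphic_on_def
proof
  fix z assume "z \<in> S"
  with assms obtain D where "(f has_derivative (\<lambda>h. h *\<^sub>C D)) (at z within S)"
    unfolding vholomorphic_on_def by blast
  from bounded_linear.has_derivative[OF scaleC.bounded_linear_right this, of c]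
  show "\<exists>D. ((\<lambda>z. c *\<^sub>C f z) has_derivative (\<lambda>h. h *\<^sub>C D)) (at z within S)"
    by (intro exI[of _ "c *\<^sub>C D"]) (simp add: scaleC_scaleC mult.commute)
qed

text \<open>The contour crosses the axis at radius exp a, inside the disc of the kernel, and meets
  larger radii only at angle at least \<epsilon> from the axis. A point t in the sector of
  half-angle \<open>\<alpha> / 4\<close> may be rotated by \<epsilon> without leaving the half-angle
  \<open>\<alpha> / 2\<close>.\<close>

locale hadamard_transform =
  fixes c :: "nat \<Rightarrow> real" and G :: "complex \<Rightarrow> complex" and x0 :: real
    and f :: "complex \<Rightarrow> 'e::complex_banach" and u :: "'e fps" and d \<alpha> r a \<epsilon> :: real
  assumes kernel: "summability_kernel c G x0"
    and f: "f vholomorphic_on disc_sector d \<alpha> r" "has_sum_near_0 u f"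
    and pos: "\<alpha> > 0" "r > 0" and a: "a < x0" and \<epsilon>: "0 < \<epsilon>" "\<epsilon> < pi" "\<epsilon> \<le> \<alpha> / 4"
begin

text \<open>Under \<open>exp\<close> the polygon becomes a closed curve around \<open>0\<close>: a circular arc of radius \<open>exp b\<close>
  away from the positive axis, joined by two radial segments to a short arc of radius \<open>exp a\<close>
  that crosses the axis.\<close>

definition vertex :: "real \<Rightarrow> nat \<Rightarrow> complex" where
  "vertex b j = [Complex a 0, Complex a \<epsilon>, Complex b \<epsilon>, Complex b (2 * pi - \<epsilon>),
     Complex a (2 * pi - \<epsilon>), Complex a (2 * pi)] ! j"

abbreviation "edge b j \<equiv> closed_segment (vertex b j) (vertex b (Suc j))"

definition transform :: "real \<Rightarrow> complex \<Rightarrow> 'e" where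
  "transform b t = inverse (2 * pi * \<i>) *\<^sub>C (\<Sum>j<5. hadamard_segment G f (vertex b j) (vertex b (Suc j)) t)"

lemma G_holomorphic: "G holomorphic_on ({\<zeta>. 0 < Im \<zeta> \<and> Im \<zeta> < 2 * pi} \<union> {\<zeta>. Re \<zeta> < x0})"
  and G_sums: "Re \<zeta> < x0 \<Longrightarrow> (\<lambda>n. of_real (c n) * exp \<zeta> ^ n) sums G \<zeta>"
  using kernel by (auto simp: summability_kernel_def)

text \<open>The last alternative sorts points by what controls the integrand: only points with real
  part a come closer than \<epsilon> to the axis, and only the edge at real part b departs from it
  by more than \<epsilon>.\<close>

lemma edge_cases:
  assumes "j < 5" "a \<le> b" "\<zeta> \<in> edge b j"
  shows "a \<le> Re \<zeta>" "Re \<zeta> \<le> b" "0 \<le> Im \<zeta>" "Im \<zeta> \<le> 2 * pi"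
    and "Re \<zeta> = a \<and> (Im \<zeta> \<le> \<epsilon> \<or> 2 * pi - \<epsilon> \<le> Im \<zeta>) \<or> Im \<zeta> = \<epsilon> \<or> Im \<zeta> = 2 * pi - \<epsilon> \<or>
      Re \<zeta> = b \<and> \<epsilon> \<le> Im \<zeta> \<and> Im \<zeta> \<le> 2 * pi - \<epsilon>"
proof -
  have sub: "p \<in> cbox l m \<Longrightarrow> q \<in> cbox l m \<Longrightarrow> \<zeta> \<in> closed_segment p q \<Longrightarrow> \<zeta> \<in> cbox l m" for p q l m
    using closed_segment_subset[of p "cbox l m" q] convex_box(1)[of l m] by blast
  have j: "j = 0 \<or> j = 1 \<or> j = 2 \<or> j = 3 \<or> j = 4" using assms(1) by auto
  note sub = sub[unfolded in_cbox_complex_iff]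
  have "a \<le> Re \<zeta> \<and> Re \<zeta> \<le> b \<and> 0 \<le> Im \<zeta> \<and> Im \<zeta> \<le> 2 * pi \<and>
    (Re \<zeta> = a \<and> (Im \<zeta> \<le> \<epsilon> \<or> 2 * pi - \<epsilon> \<le> Im \<zeta>) \<or> Im \<zeta> = \<epsilon> \<or> Im \<zeta> = 2 * pi - \<epsilon> \<or>
      Re \<zeta> = b \<and> \<epsilon> \<le> Im \<zeta> \<and> Im \<zeta> \<le> 2 * pi - \<epsilon>)"
    using j
  proof (elim disjE)
    assume "j = 0"
    then show ?thesis using assms \<epsilon> sub[of "Complex a 0" "Complex a 0" "Complex a \<epsilon>" "Complex a \<epsilon>"]
      by (simp add: vertex_def)
  next
    assume "j = 1"
    then show ?thesis using assms \<epsilon> sub[of "Complex a \<epsilon>" "Complex a \<epsilon>" "Complex b \<epsilon>" "Complex b \<epsilon>"]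
      by (simp add: vertex_def)
  next
    assume "j = 2"
    then show ?thesis using assms \<epsilon>
        sub[of "Complex b \<epsilon>" "Complex b \<epsilon>" "Complex b (2 * pi - \<epsilon>)" "Complex b (2 * pi - \<epsilon>)"]
      by (simp add: vertex_def numeral_eq_Suc)
  next
    assume "j = 3"
    then show ?thesis using assms \<epsilon>
        sub[of "Complex b (2 * pi - \<epsilon>)" "Complex a (2 * pi - \<epsilon>)" "Complex b (2 * pi - \<epsilon>)" "Complex a (2 * pi - \<epsilon>)"]
      by (simp add: vertex_def numeral_eq_Suc)
  next
    assume "j = 4"
    then show ?thesis using assms \<epsilon>
        sub[of "Complex a (2 * pi - \<epsilon>)" "Complex a (2 * pi - \<epsilon>)" "Complex a (2 * pi)" "Complex a (2 * pi)"]
      by (simp add: vertex_def numeral_eq_Suc)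
  qed
  then show "a \<le> Re \<zeta>" "Re \<zeta> \<le> b" "0 \<le> Im \<zeta>" "Im \<zeta> \<le> 2 * pi"
    and "Re \<zeta> = a \<and> (Im \<zeta> \<le> \<epsilon> \<or> 2 * pi - \<epsilon> \<le> Im \<zeta>) \<or> Im \<zeta> = \<epsilon> \<or> Im \<zeta> = 2 * pi - \<epsilon> \<or>
      Re \<zeta> = b \<and> \<epsilon> \<le> Im \<zeta> \<and> Im \<zeta> \<le> 2 * pi - \<epsilon>" by blast+
qed

lemma continuous_on_edge:
  assumes "j < 5" "a \<le> b" shows "continuous_on (edge b j) G"
proof (rule continuous_on_subset[OF holomorphic_on_imp_continuous_on[OF G_holomorphic]])
  show "edge b j \<subseteq> {\<zeta>. 0 < Im \<zeta> \<and> Im \<zeta> < 2 * pi} \<union> {\<zeta>. Re \<zeta> < x0}"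
  proof
    fix \<zeta> assume "\<zeta> \<in> edge b j"
    from edge_cases(5)[OF assms this] a \<epsilon>
    show "\<zeta> \<in> {\<zeta>. 0 < Im \<zeta> \<and> Im \<zeta> < 2 * pi} \<union> {\<zeta>. Re \<zeta> < x0}" by auto
  qed
qed

text \<open>On the far edge |t / w| = |t| exp (- b) < r. Elsewhere either t is so small that |w| >=
  exp a suffices, or w has argument within \<epsilon> of the axis and t / w stays in the wider
  sector.\<close>

lemma edge_maps:
  assumes "j < 5" "a \<le> b" "\<zeta> \<in> edge b j" and t: "t \<in> disc_sector d (\<alpha> / 2) (r * exp a)" "cmod t < r * exp b"
  shows "t * exp (- \<zeta>) \<in> disc_sector d \<alpha> r"
proof -
  note \<zeta> = edge_cases[OF assms(1-3)]
  have small: ?thesis if "cmod t < r * exp x" "x \<le> Re \<zeta>" for x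
  proof -
    have "cmod (t * exp (- \<zeta>)) \<le> cmod t * exp (- x)"
      using that(2) by (simp add: norm_mult mult_left_mono)
    also have "\<dots> < r * exp x * exp (- x)" using that(1) by (intro mult_strict_right_mono) auto
    also have "\<dots> = r" by (simp add: mult.assoc flip: exp_add)
    finally show ?thesis by (simp add: disc_sector_def)
  qed
  show ?thesis
  proof (cases "cmod t < r * exp a \<or> Re \<zeta> = b")
    case True
    then show ?thesis using small[of a] small[of b] \<zeta>(1) t(2) by auto
  next
    case False
    then have "t \<in> sector d (\<alpha> / 2)" using t(1) by (auto simp: disc_sector_def)
    then obtain w where w: "t = exp w" "d - \<alpha>/2/2 < Im w" "Im w < d + \<alpha>/2/2"
      unfolding sector_eq_exp_image by blast
    \<comment> \<open>The second form is for the edges near Im \<zeta> = 2 pi: the added period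
      brings the argument back close to that of t.\<close>
    have *: "t * exp (- \<zeta>) = exp (w - \<zeta>)" "t * exp (- \<zeta>) = exp (w - \<zeta> + 2 * pi * \<i>)"
      by (simp_all add: w(1) exp_add exp_diff exp_minus divide_inverse)
    have "Im \<zeta> \<le> \<epsilon> \<or> 2 * pi - \<epsilon> \<le> Im \<zeta>" using False \<zeta>(5) by auto
    then have "t * exp (- \<zeta>) \<in> sector d \<alpha>"
    proof
      assume "Im \<zeta> \<le> \<epsilon>"
      then show ?thesis using w \<zeta>(3) \<epsilon> pos unfolding sector_eq_exp_image *(1) by (intro imageI) auto
    next
      assume "2 * pi - \<epsilon> \<le> Im \<zeta>"
      then show ?thesis using w \<zeta>(4) \<epsilon> pos unfolding sector_eq_exp_image *(2) by (intro imageI) auto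
    qed
    then show ?thesis by (simp add: disc_sector_def)
  qed
qed

lemma vholomorphic_on_transform:
  assumes "a \<le> b"
  shows "transform b vholomorphic_on (disc_sector d (\<alpha> / 2) (r * exp a) \<inter> ball 0 (r * exp b))"
proof -
  let ?T = "disc_sector d (\<alpha> / 2) (r * exp a) \<inter> ball 0 (r * exp b)"
  have "(\<lambda>t. \<Sum>j<n. hadamard_segment G f (vertex b j) (vertex b (Suc j)) t) vholomorphic_on ?T"
    if "n \<le> 5" for n
    using that
  proof (induction n)
    case 0
    show ?case unfolding vholomorphic_on_def
      by (intro ballI exI[of _ 0]) (simp add: scaleC.zero_right)
  next
    case (Suc n)
    have "hadamard_segment G f (vertex b n) (vertex b (Suc n)) vholomorphic_on ?T"
      using Suc.prems assms
      by (intro vholomorphic_on_hadamard_segment[OF _ f(1)] continuous_on_edge edge_maps open_disc_sector open_Int)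
        auto
    with Suc show ?case by (auto intro: vholomorphic_on_add)
  qed
  from vholomorphic_on_scaleC_left[OF this[of 5]] show ?thesis by (simp add: transform_def[abs_def])
qed

text \<open>An edge is no longer than b - a + 2 pi. With b comparable to log |t| for large t, this
  length is negligible against the exponential factors.\<close>

lemma norm_transform_le:
  assumes "a \<le> b" "t \<in> disc_sector d (\<alpha> / 2) (r * exp a)" "cmod t < r * exp b"
    and "\<And>j \<zeta>. j < 5 \<Longrightarrow> \<zeta> \<in> edge b j \<Longrightarrow> cmod (G \<zeta>) \<le> A"
    and "\<And>j \<zeta>. j < 5 \<Longrightarrow> \<zeta> \<in> edge b j \<Longrightarrow> norm (f (t * exp (- \<zeta>))) \<le> B"
  shows "norm (transform b t) \<le> 5 * ((b - a) + 2 * pi) * (A * B)"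
proof -
  have AB: "0 \<le> A * B"
  proof (rule mult_nonneg_nonneg)
    show "0 \<le> A" using order_trans[OF norm_ge_zero assms(4)[of 0 "vertex b 0"]] by simp
    show "0 \<le> B" using order_trans[OF norm_ge_zero assms(5)[of 0 "vertex b 0"]] by simp
  qed
  have len: "cmod (vertex b (Suc j) - vertex b j) \<le> (b - a) + 2 * pi" if "j < 5" for j
  proof -
    note * = edge_cases(1-4)[OF that assms(1), of "vertex b j"] edge_cases(1-4)[OF that assms(1), of "vertex b (Suc j)"]
    have "\<bar>Re (vertex b (Suc j) - vertex b j)\<bar> \<le> b - a" "\<bar>Im (vertex b (Suc j) - vertex b j)\<bar> \<le> 2 * pi"
      using * by auto
    then show ?thesis using cmod_le[of "vertex b (Suc j) - vertex b j"] by linarith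
  qed
  have le: "norm (inverse (2 * pi * \<i>) *\<^sub>C x) \<le> norm x" for x :: 'e
  proof -
    have "cmod (inverse (2 * pi * \<i>)) \<le> 1"
      using pi_gt3 le_imp_inverse_le[of 1 pi] by (simp add: norm_mult norm_inverse)
    from mult_right_mono[OF this norm_ge_zero[of x]] show ?thesis by (simp only: norm_scaleC mult_1)
  qed
  have "norm (transform b t) \<le> norm (\<Sum>j<5. hadamard_segment G f (vertex b j) (vertex b (Suc j)) t)"
    unfolding transform_def by (rule le)
  also have "\<dots> \<le> (\<Sum>j<5::nat. ((b - a) + 2 * pi) * (A * B))"
  proof (rule sum_norm_le)
    fix j :: nat assume "j \<in> {..<5}"
    then have j: "j < 5" by simp
    have "norm (hadamard_segment G f (vertex b j) (vertex b (Suc j)) t)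
        \<le> cmod (vertex b (Suc j) - vertex b j) * (A * B)"
      by (rule norm_hadamard_segment_le[OF continuous_on_edge[OF j assms(1)] f(1) open_disc_sector])
        (use edge_maps[OF j assms(1) _ assms(2,3)] assms(4,5)[OF j] in auto)
    also have "\<dots> \<le> ((b - a) + 2 * pi) * (A * B)" using AB len[OF j] by (intro mult_right_mono)
    finally show "norm (hadamard_segment G f (vertex b j) (vertex b (Suc j)) t) \<le> ((b - a) + 2 * pi) * (A * B)" .
  qed
  finally show ?thesis by (simp add: algebra_simps)
qed

text \<open>Near the origin the polygon can be deformed to a segment of length \<open>2\<pi>\<close>, which the
  exponential maps to a full circle.\<close>

lemma transform_sums_near_0:
  obtains \<rho> where "0 < \<rho>" "\<rho> \<le> r * exp a"
    "\<And>b t. a \<le> b \<Longrightarrow> t \<in> ball 0 \<rho> \<Longrightarrow> (\<lambda>n. t ^ n *\<^sub>C c n *\<^sub>R fps_nth u n) sums transform b t"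
proof -
  obtain \<rho>0 C' where \<rho>0: "\<rho>0 > 0" "\<And>n. norm (fps_nth u n) * \<rho>0 ^ n \<le> C'"
    "\<And>t. cmod t \<le> \<rho>0 \<Longrightarrow> (\<lambda>n. t ^ n *\<^sub>C fps_nth u n) sums f t"
    using has_sum_near_0_coeff_bound[OF f(2)] by metis
  define \<rho> where "\<rho> = min \<rho>0 r"
  have \<rho>: "\<rho> > 0" "\<rho> \<le> \<rho>0" "\<rho> \<le> r" using \<rho>0(1) pos by (auto simp: \<rho>_def)
  have u: "norm (fps_nth u n) * \<rho> ^ n \<le> C'" for n
  proof -
    have "norm (fps_nth u n) * \<rho> ^ n \<le> norm (fps_nth u n) * \<rho>0 ^ n"
      using \<rho> by (intro mult_left_mono power_mono) auto
    with \<rho>0(2)[of n] show ?thesis by linarith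
  qed
  \<comment> \<open>Room between a and \<open>x0\<close>: the coefficient bound at radius exp x1
    leaves a geometric margin on the circle of radius exp a.\<close>
  obtain x1 where x1: "a < x1" "x1 < x0" using dense[OF a] by blast
  define s where "s = exp x1"
  have s: "exp a < s" "s > 0" using x1 by (auto simp: s_def)
  have "(\<lambda>n. of_real s ^ n *\<^sub>C complex_of_real (c n)) sums G (of_real x1)"
    using G_sums[of "of_real x1"] x1 by (simp add: s_def scaleC_complex_def exp_of_real mult.commute)
  from power_series_coeff_bound[OF sums_summable[OF this]]
  obtain C where "\<And>n. cmod (of_real (c n)) * cmod (of_real s) ^ n \<le> C" by blast
  then have C: "\<bar>c n\<bar> * s ^ n \<le> C" for n using s by simp
  show ?thesis
  proof
    show "0 < \<rho> * exp a" "\<rho> * exp a \<le> r * exp a" using \<rho> by auto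
    fix b and t :: complex assume b: "a \<le> b" and "t \<in> ball 0 (\<rho> * exp a)"
    then have t: "cmod t < \<rho> * exp a" by simp
    have C0: "0 \<le> C" using C[of 0] by simp
    let ?S = "\<Sum>n. t ^ n *\<^sub>C c n *\<^sub>R fps_nth u n"
    have "norm (c n *\<^sub>R fps_nth u n) * (s * \<rho>) ^ n \<le> C * C'" for n
    proof -
      have "norm (c n *\<^sub>R fps_nth u n) * (s * \<rho>) ^ n = (\<bar>c n\<bar> * s ^ n) * (norm (fps_nth u n) * \<rho> ^ n)"
        by (simp add: power_mult_distrib)
      also have "\<dots> \<le> C * C'"
        using s \<rho> C0 by (intro mult_mono C u) auto
      finally show ?thesis .
    qed
    moreover have "cmod t < s * \<rho>"
      using t mult_strict_left_mono[OF s(1) \<rho>(1)] by (simp add: mult.commute)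
    ultimately have "summable (\<lambda>n. t ^ n *\<^sub>C c n *\<^sub>R fps_nth u n)"
      by (rule power_series_abs_summable(1)[OF _ order_refl])
    then have S: "(\<lambda>n. t ^ n *\<^sub>C c n *\<^sub>R fps_nth u n) sums ?S" by (rule summable_sums)
    have "?S = transform b t"
    proof (rule functionals_separate)
      fix \<phi> :: "'e \<Rightarrow> complex" assume \<phi>: "\<phi> \<in> functionals"
      interpret bounded_linear \<phi> by (rule functionals_bounded_linear[OF \<phi>])
      let ?\<psi> = "\<lambda>\<zeta>. G \<zeta> * \<phi> (f (t * exp (- \<zeta>)))"
      let ?L = "\<lambda>p q. contour_integral (linepath p q) ?\<psi>"
      \<comment> \<open>A radius slightly below exp a at which t / w is still in the disc. It makes
        room for open regions that contain the edges with real part a.\<close>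
      obtain y where y: "cmod t / \<rho> < y" "y < exp a"
        using dense[of "cmod t / \<rho>" "exp a"] t \<rho> by (auto simp: field_simps)
      then have "y > 0" using \<rho> divide_nonneg_pos[OF norm_ge_zero[of t], of \<rho>] by linarith
      define a' where "a' = ln y"
      have a': "a' < a" "cmod t < \<rho> * exp a'"
        using y \<open>y > 0\<close> \<rho> ln_less_cancel_iff[of y "exp a"] by (auto simp: a'_def field_simps)
      have maps: "cmod (t * exp (- \<zeta>)) < \<rho>" if "a' < Re \<zeta>" for \<zeta>
      proof -
        have "cmod (t * exp (- \<zeta>)) \<le> cmod t * exp (- a')"
          using that by (simp add: norm_mult mult_left_mono)
        also have "\<dots> < \<rho> * exp a' * exp (- a')" using a' by (intro mult_strict_right_mono) auto
        finally show ?thesis by (simp add: mult.assoc flip: exp_add)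
      qed
      have \<psi>: "?\<psi> holomorphic_on S"
        if "S \<subseteq> {\<zeta>. a' < Re \<zeta>}" "S \<subseteq> {\<zeta>. 0 < Im \<zeta> \<and> Im \<zeta> < 2 * pi} \<union> {\<zeta>. Re \<zeta> < x0}" for S
      proof (intro holomorphic_intros)
        show "G holomorphic_on S" using G_holomorphic that(2) by (rule holomorphic_on_subset)
        have "(\<lambda>w. \<phi> (f w)) \<circ> (\<lambda>\<zeta>. t * exp (- \<zeta>)) holomorphic_on S"
        proof (rule holomorphic_on_compose_gen)
          show "(\<lambda>w. \<phi> (f w)) holomorphic_on disc_sector d \<alpha> r"
            using f(1) \<phi> by (rule holomorphic_on_functional)
          show "(\<lambda>\<zeta>. t * exp (- \<zeta>)) ` S \<subseteq> disc_sector d \<alpha> r"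
            using that(1) maps \<rho> by (fastforce simp: disc_sector_def)
        qed (intro holomorphic_intros)
        then show "(\<lambda>\<zeta>. \<phi> (f (t * exp (- \<zeta>)))) holomorphic_on S" by (simp add: o_def)
      qed
      \<comment> \<open>Two deformations in convex regions where the integrand has a primitive: in
        the strip, the path from vertex 1 to vertex 4 becomes one segment; in the band left of
        \<open>x0\<close>, the path from vertex 0 to vertex 5 does.\<close>
      let ?D1 = "{\<zeta>. a' < Re \<zeta>} \<inter> ({\<zeta>. 0 < Im \<zeta>} \<inter> {\<zeta>. Im \<zeta> < 2 * pi})"
      let ?D2 = "{\<zeta>. a' < Re \<zeta>} \<inter> {\<zeta>. Re \<zeta> < x0}"
      have D: "convex ?D1" "open ?D1" "convex ?D2" "open ?D2"
        by (intro convex_Int open_Int convex_halfspace_Re_gt convex_halfspace_Re_lt convex_halfspace_Im_gt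
            convex_halfspace_Im_lt open_halfspace_Re_gt open_halfspace_Re_lt open_halfspace_Im_gt
            open_halfspace_Im_lt)+
      have \<psi>D: "?\<psi> holomorphic_on ?D1" "?\<psi> holomorphic_on ?D2" by (rule \<psi>; blast)+
      obtain P1 where P1: "\<And>p q. p \<in> ?D1 \<Longrightarrow> q \<in> ?D1 \<Longrightarrow> ?L p q = P1 q - P1 p"
        using holomorphic_convex_linepath_primitive[OF D(1,2) \<psi>D(1)] by blast
      obtain P2 where P2: "\<And>p q. p \<in> ?D2 \<Longrightarrow> q \<in> ?D2 \<Longrightarrow> ?L p q = P2 q - P2 p"
        using holomorphic_convex_linepath_primitive[OF D(3,4) \<psi>D(2)] by blast
      have D1: "vertex b j \<in> ?D1" if "j \<in> {1..4}" for j
      proof -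
        have "j = 1 \<or> j = 2 \<or> j = 3 \<or> j = 4" using that by auto
        then show ?thesis using a' b \<epsilon> by (elim disjE) (simp_all add: vertex_def numeral_eq_Suc)
      qed
      have D2: "vertex b j \<in> ?D2" if "j \<in> {0, 1, 4, 5}" for j
        using that a' a by (auto simp: vertex_def numeral_eq_Suc)
      have "(\<Sum>j<5. ?L (vertex b j) (vertex b (Suc j))) =
          ?L (vertex b 0) (vertex b 1) + (?L (vertex b 1) (vertex b 2) + ?L (vertex b 2) (vertex b 3) +
          ?L (vertex b 3) (vertex b 4)) + ?L (vertex b 4) (vertex b 5)"
        by (simp only: eval_nat_numeral sum.lessThan_Suc lessThan_0 sum.empty One_nat_def add_0_left BitM.simps)
          (simp only: add.assoc)
      also have "?L (vertex b 1) (vertex b 2) + ?L (vertex b 2) (vertex b 3) + ?L (vertex b 3) (vertex b 4) =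
          ?L (vertex b 1) (vertex b 4)"
        using P1[OF D1 D1, of 1 2] P1[OF D1 D1, of 2 3] P1[OF D1 D1, of 3 4] P1[OF D1 D1, of 1 4] by simp
      also have "?L (vertex b 0) (vertex b 1) + ?L (vertex b 1) (vertex b 4) + ?L (vertex b 4) (vertex b 5) =
          ?L (vertex b 0) (vertex b 5)"
        using P2[OF D2 D2, of 0 1] P2[OF D2 D2, of 1 4] P2[OF D2 D2, of 4 5] P2[OF D2 D2, of 0 5] by simp
      also have "\<dots> = ?L (of_real a) (of_real a + 2 * pi * \<i>)"
      proof -
        have "vertex b 0 = of_real a" "vertex b 5 = of_real a + 2 * pi * \<i>"
          by (simp_all add: vertex_def complex_eq_iff)
        then show ?thesis by simp
      qed
      finally have L: "(\<Sum>j<5. ?L (vertex b j) (vertex b (Suc j))) = ?L (of_real a) (of_real a + 2 * pi * \<i>)" .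
      have "\<phi> (transform b t) = inverse (2 * pi * \<i>) * (\<Sum>j<5. \<phi> (hadamard_segment G f (vertex b j) (vertex b (Suc j)) t))"
        by (simp add: transform_def functionals_scaleC[OF \<phi>] sum)
      also have "(\<Sum>j<5. \<phi> (hadamard_segment G f (vertex b j) (vertex b (Suc j)) t)) =
          (\<Sum>j<5. ?L (vertex b j) (vertex b (Suc j)))"
      proof (intro sum.cong refl functional_hadamard_segment[OF continuous_on_edge f(1) open_disc_sector _ \<phi>])
        fix j \<zeta> assume "j \<in> {..<5::nat}" "\<zeta> \<in> edge b j"
        then have "a \<le> Re \<zeta>" using edge_cases(1)[OF _ b] by simp
        then show "t * exp (- \<zeta>) \<in> disc_sector d \<alpha> r"
          using maps[of \<zeta>] a' \<rho> by (simp add: disc_sector_def)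
      qed (use b in auto)
      finally have T: "\<phi> (transform b t) = inverse (2 * pi * \<i>) * ?L (of_real a) (of_real a + 2 * pi * \<i>)"
        unfolding L .
      have sums: "(\<lambda>n. 2 * pi * \<i> * (of_real (c n) * \<phi> (fps_nth u n) * t ^ n)) sums ?L (of_real a) (of_real a + 2 * pi * \<i>)"
      proof (rule contour_integral_linepath_hadamard[where s = s and C = C and r = \<rho> and C' = "2 * C'" and H = "\<lambda>w. \<phi> (f w)"])
        show "cmod (complex_of_real (c n)) * s ^ n \<le> C" for n using C by simp
        show "cmod (\<phi> (fps_nth u n)) * \<rho> ^ n \<le> 2 * C'" for n
        proof -
          have "cmod (\<phi> (fps_nth u n)) * \<rho> ^ n \<le> 2 * norm (fps_nth u n) * \<rho> ^ n"
            using \<rho> by (intro mult_right_mono functionals_bound \<phi>) auto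
          with u[of n] show ?thesis by simp
        qed
        show "cmod t * exp (- Re (of_real a)) < \<rho>" using maps[of "of_real a"] a' by (simp add: norm_mult)
        show "(\<lambda>n. of_real (c n) * exp \<zeta> ^ n) sums G \<zeta>" if "Re \<zeta> = Re (of_real a)" for \<zeta>
          using that a by (intro G_sums) simp
        show "(\<lambda>n. \<phi> (fps_nth u n) * w ^ n) sums \<phi> (f w)" if "cmod w < \<rho>" for w
          using that \<rho> by (intro functional_sums \<phi> \<rho>0(3)) simp
        have "closed_segment (complex_of_real a) (of_real a + 2 * pi * \<i>) \<subseteq> {\<zeta>. Re \<zeta> < x0}"
          using a by (intro closed_segment_subset convex_halfspace_Re_lt) auto
        then show "continuous_on (closed_segment (complex_of_real a) (of_real a + 2 * pi * \<i>)) G"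
          by (intro continuous_on_subset[OF holomorphic_on_imp_continuous_on[OF G_holomorphic]]) auto
      qed (use s in auto)
      have inv: "inverse (2 * pi * \<i>) * (2 * pi * \<i> * z) = z" for z
        by (subst mult.assoc[symmetric], subst left_inverse) simp_all
      from sums_mult[OF sums, of "inverse (2 * pi * \<i>)"]
      have "(\<lambda>n. of_real (c n) * \<phi> (fps_nth u n) * t ^ n) sums \<phi> (transform b t)"
        unfolding T inv .
      moreover have "(\<lambda>n. of_real (c n) * \<phi> (fps_nth u n) * t ^ n) sums \<phi> ?S"
        using functional_sums[OF \<phi> S] by (simp add: scaleR scaleR_conv_of_real)
      ultimately show "\<phi> ?S = \<phi> (transform b t)" by (rule sums_unique2[symmetric])
    qed
    with S show "(\<lambda>n. t ^ n *\<^sub>C c n *\<^sub>R fps_nth u n) sums transform b t" by simp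
  qed
qed

end

text \<open>Both contours give the same power series near 0, and the domain is connected. The
  identity theorem thus replaces a deformation of contours for large t.\<close>

lemma (in hadamard_transform) transform_eq:
  assumes b: "a \<le> b" "b \<le> b'" and t: "t \<in> disc_sector d (\<alpha> / 2) (r * exp a) \<inter> ball 0 (r * exp b)"
  shows "transform b t = transform b' t"
proof -
  obtain \<rho> where \<rho>: "0 < \<rho>" "\<rho> \<le> r * exp a"
    "\<And>b t. a \<le> b \<Longrightarrow> t \<in> ball 0 \<rho> \<Longrightarrow> (\<lambda>n. t ^ n *\<^sub>C c n *\<^sub>R fps_nth u n) sums transform b t"
    using transform_sums_near_0 by metis
  let ?T = "disc_sector d (\<alpha> / 2) (r * exp a) \<inter> ball 0 (r * exp b)"
  have mono: "r * exp a \<le> r * exp b" "r * exp b \<le> r * exp b'" using b pos by auto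
  show ?thesis
  proof (rule vholomorphic_on_unique[of "ball 0 \<rho>" ?T])
    show "ball 0 \<rho> \<subseteq> ?T" using \<rho>(2) mono by (auto simp: disc_sector_def)
    show "open ?T" by (intro open_Int open_disc_sector open_ball)
    show "connected ?T" using pos by (intro connected_disc_sector_ball) auto
    show "transform b vholomorphic_on ?T" by (rule vholomorphic_on_transform[OF b(1)])
    show "transform b' vholomorphic_on ?T"
      using b mono by (intro vholomorphic_on_subset[OF vholomorphic_on_transform]) auto
    show "transform b z = transform b' z" if "z \<in> ball 0 \<rho>" for z
      using \<rho>(3)[of b z] \<rho>(3)[of b' z] that b sums_unique2 by auto
  qed (use \<rho>(1) t in auto)
qed

section \<open>Contours that move with t\<close>

lemma powr_add_le:
  fixes p x k :: real assumes "p \<ge> 0" "x \<ge> 0" "k > 0"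
  shows "(p + x) powr k \<le> (2 * p) powr k + (2 * x) powr k"
proof (cases "p \<le> x")
  case True
  then have "(p + x) powr k \<le> (2 * x) powr k" using assms by (intro powr_mono2) auto
  then show ?thesis by (simp add: add_increasing)
next
  case False
  then have "(p + x) powr k \<le> (2 * p) powr k" using assms by (intro powr_mono2) auto
  then show ?thesis by (simp add: add_increasing2)
qed

text \<open>The constants must not depend on b. Points near the axis lie on one fixed compact
  segment with real part a, where G is bounded; at the others the kernel estimate applies with real
  part at most b.\<close>

lemma (in hadamard_transform) edge_kernel_bound:
  assumes "k > 0"
  obtains A B where "A \<ge> 0" "B \<ge> 0"
    "\<And>b j \<zeta>. a \<le> b \<Longrightarrow> j < 5 \<Longrightarrow> \<zeta> \<in> edge b j \<Longrightarrow> cmod (G \<zeta>) \<le> A * exp (B * exp (k * b))"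
proof -
  obtain A B where AB: "\<And>\<zeta>. \<epsilon> \<le> Im \<zeta> \<Longrightarrow> Im \<zeta> \<le> 2 * pi - \<epsilon> \<Longrightarrow> cmod (G \<zeta>) \<le> A * exp (B * exp (k * Re \<zeta>))"
    using kernel assms \<epsilon>(1) unfolding summability_kernel_def by metis
  let ?K = "closed_segment (Complex a 0) (Complex a (2 * pi))"
  have "?K \<subseteq> {\<zeta>. Re \<zeta> < x0}"
    using a by (intro closed_segment_subset convex_halfspace_Re_lt) auto
  then have "continuous_on ?K G"
    by (intro continuous_on_subset[OF holomorphic_on_imp_continuous_on[OF G_holomorphic]]) auto
  then have "compact (G ` ?K)" by (intro compact_continuous_image) auto
  then obtain M where M: "\<And>\<zeta>. \<zeta> \<in> ?K \<Longrightarrow> cmod (G \<zeta>) \<le> M"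
    using compact_imp_bounded bounded_pos by (metis image_eqI)
  have "M \<ge> 0" using order_trans[OF norm_ge_zero M[of "Complex a 0"]] by simp
  show ?thesis
  proof
    show "0 \<le> \<bar>A\<bar> + M" "0 \<le> \<bar>B\<bar>" using \<open>M \<ge> 0\<close> by auto
    fix b j \<zeta> assume *: "a \<le> b" "j < 5" "\<zeta> \<in> edge b j"
    note e = edge_cases[OF *(2,1,3)]
    show "cmod (G \<zeta>) \<le> (\<bar>A\<bar> + M) * exp (\<bar>B\<bar> * exp (k * b))"
    proof (cases "\<epsilon> \<le> Im \<zeta> \<and> Im \<zeta> \<le> 2 * pi - \<epsilon>")
      case True
      then have "cmod (G \<zeta>) \<le> A * exp (B * exp (k * Re \<zeta>))" using AB by blast
      also have "\<dots> \<le> (\<bar>A\<bar> + M) * exp (\<bar>B\<bar> * exp (k * b))"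
      proof (intro mult_mono)
        have "B * exp (k * Re \<zeta>) \<le> \<bar>B\<bar> * exp (k * b)"
          using assms e(2) by (intro mult_mono) auto
        then show "exp (B * exp (k * Re \<zeta>)) \<le> exp (\<bar>B\<bar> * exp (k * b))" by simp
      qed (use \<open>M \<ge> 0\<close> in auto)
      finally show ?thesis .
    next
      case False
      then have "Re \<zeta> = a" using e(5) \<epsilon> by auto
      have "\<zeta> \<in> ?K"
      proof -
        have "\<zeta> = (1 - Im \<zeta> / (2 * pi)) *\<^sub>R Complex a 0 + (Im \<zeta> / (2 * pi)) *\<^sub>R Complex a (2 * pi)"
          using \<open>Re \<zeta> = a\<close> by (simp add: complex_eq_iff algebra_simps)
        then show ?thesis
          using e(3,4) unfolding in_segment by (intro exI[of _ "Im \<zeta> / (2 * pi)"]) auto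
      qed
      then have "cmod (G \<zeta>) \<le> M * 1" using M by simp
      also have "\<dots> \<le> (\<bar>A\<bar> + M) * exp (\<bar>B\<bar> * exp (k * b))"
        using \<open>M \<ge> 0\<close> by (intro mult_mono) auto
      finally show ?thesis .
    qed
  qed
qed

text \<open>The far radius \<open>exp (\<beta> t)\<close> is comparable to 1 + |t|: large enough to
  send t / w into the disc, small enough for the kernel bound to stay of order k. The factor f has
  growth of order k as |w| >= exp a. By \<open>transform_eq\<close> the moving contours define one
  holomorphic function.\<close>

lemma exp_growth_functions_hadamard:
  fixes u v :: "'e::complex_banach fps"
  assumes kernel: "summability_kernel c G x0" and k: "k > 0" and pos: "\<alpha> > 0" "r > 0"
    and f: "f \<in> exp_growth_functions k d \<alpha> r" "has_sum_near_0 u f"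
    and v: "\<And>n. fps_nth v n = c n *\<^sub>R fps_nth u n"
  shows "\<exists>\<alpha>'>0. \<exists>r'>0. \<exists>g\<in>exp_growth_functions k d \<alpha>' r'. has_sum_near_0 v g"
proof -
  \<comment> \<open>The growth bound for f is available only on strictly smaller
    disc-sectors.\<close>
  define \<alpha>0 r0 where "\<alpha>0 = \<alpha> / 2" "r0 = r / 2"
  have pos0: "\<alpha>0 > 0" "r0 > 0" "\<alpha>0 \<in> {0<..<\<alpha>}" "r0 \<in> {0<..<r}" using pos by (auto simp: \<alpha>0_r0_def)
  then obtain Af Bf where f_bound: "Af > 0" "Bf > 0"
    "\<And>t. t \<in> disc_sector d \<alpha>0 r0 \<Longrightarrow> norm (f t) < Af * exp (Bf * cmod t powr k)"
    using f(1) unfolding exp_growth_functions_def by blast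
  define a \<epsilon> where "a = x0 - 1" "\<epsilon> = min (\<alpha>0 / 4) 1"
  interpret hadamard_transform c G x0 f u d \<alpha>0 r0 a \<epsilon>
  proof
    show "f vholomorphic_on disc_sector d \<alpha>0 r0"
      using f(1) pos disc_sector_mono[of \<alpha>0 \<alpha> r0 r d] unfolding exp_growth_functions_def
      by (auto simp: \<alpha>0_r0_def intro: vholomorphic_on_subset)
    show "\<epsilon> < pi" using pi_gt3 by (auto simp: a_\<epsilon>_def min_def)
  qed (use kernel f(2) pos0 in \<open>auto simp: a_\<epsilon>_def\<close>)
  obtain A B where AB: "A \<ge> 0" "B \<ge> 0"
    "\<And>b j \<zeta>. a \<le> b \<Longrightarrow> j < 5 \<Longrightarrow> \<zeta> \<in> edge b j \<Longrightarrow> cmod (G \<zeta>) \<le> A * exp (B * exp (k * b))"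
    using edge_kernel_bound[OF k] by metis
  define T where "T = disc_sector d (\<alpha>0 / 2) (r0 * exp a)"
  define \<beta> where "\<beta> t = ln (exp a + 2 * cmod t / r0)" for t
  have exp_\<beta>: "exp (\<beta> t) = exp a + 2 * cmod t / r0" for t
    unfolding \<beta>_def using pos0 by (intro exp_ln add_pos_nonneg) auto
  have \<beta>: "a \<le> \<beta> t" "cmod t < r0 * exp (\<beta> t)" for t
  proof -
    have "exp a \<le> exp (\<beta> t)" unfolding exp_\<beta> using pos0 by simp
    then show "a \<le> \<beta> t" by simp
    have "r0 * exp a > 0" using pos0 by simp
    moreover have "r0 * exp (\<beta> t) = r0 * exp a + 2 * cmod t"
      unfolding exp_\<beta> using pos0 by (simp add: distrib_left)
    ultimately show "cmod t < r0 * exp (\<beta> t)" using norm_ge_zero[of t] by linarith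
  qed
  define F where "F t = transform (\<beta> t) t" for t
  have F_eq: "F t = transform b t" if "t \<in> T" "a \<le> b" "cmod t < r0 * exp b" for t b
  proof (cases "\<beta> t \<le> b")
    case True
    have "t \<in> disc_sector d (\<alpha>0 / 2) (r0 * exp a) \<inter> ball 0 (r0 * exp (\<beta> t))"
      using that(1) \<beta>(2)[of t] by (simp add: T_def)
    then show ?thesis unfolding F_def by (rule transform_eq[OF \<beta>(1) True])
  next
    case False
    have "t \<in> disc_sector d (\<alpha>0 / 2) (r0 * exp a) \<inter> ball 0 (r0 * exp b)"
      using that(1,3) by (simp add: T_def)
    then show ?thesis unfolding F_def using transform_eq[OF that(2), of "\<beta> t" t] False by simp
  qed
  have hol: "F vholomorphic_on T"
  proof (rule vholomorphic_on_open_cover)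
    fix z assume z: "z \<in> T"
    let ?U = "T \<inter> ball 0 (r0 * exp (\<beta> z))"
    have "open ?U" unfolding T_def by (intro open_Int open_disc_sector open_ball)
    moreover have "z \<in> ?U" using z \<beta>(2)[of z] by simp
    moreover have "transform (\<beta> z) vholomorphic_on ?U"
      unfolding T_def by (rule vholomorphic_on_transform[OF \<beta>(1)])
    moreover have "\<forall>w\<in>?U. F w = transform (\<beta> z) w" using F_eq \<beta>(1) by auto
    ultimately show "\<exists>U g. open U \<and> z \<in> U \<and> g vholomorphic_on U \<and> (\<forall>w\<in>U. F w = g w)" by blast
  qed
  obtain \<rho> where \<rho>: "0 < \<rho>" "\<rho> \<le> r0 * exp a"
    "\<And>b t. a \<le> b \<Longrightarrow> t \<in> ball 0 \<rho> \<Longrightarrow> (\<lambda>n. t ^ n *\<^sub>C c n *\<^sub>R fps_nth u n) sums transform b t"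
    using transform_sums_near_0 by metis
  have sum: "has_sum_near_0 v F"
    unfolding has_sum_near_0_def v using \<rho>(1,3) \<beta>(1) by (auto simp: F_def)
  \<comment> \<open>With X = |t|^k and Y = exp (k \<beta>): \<open>E * Y\<close> is exp (k (\<beta>
    - a)), \<open>E' * X\<close> bounds |t / w|^k, and Y <= P + Q X. The 1 added to
    \<open>A'\<close> below yields the strict inequality of the growth class.\<close>
  define E E' P Q where "E = exp (- (k * a))" "E' = exp (- a) powr k" "P = (2 * exp a) powr k" "Q = (4 / r0) powr k"
  define K where "K = 5 * (1 / k + 2 * pi) * A * Af"
  define A' B' where "A' = K * exp ((E + B) * P) + 1" "B' = (E + B) * Q + Bf * E' + 1"
  have K0: "K \<ge> 0" using k AB f_bound by (simp add: K_def)
  have pos': "A' > 0" "B' > 0"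
    using K0 AB f_bound by (auto simp: A'_B'_def E_E'_P_Q_def intro!: add_nonneg_pos add_nonneg_nonneg)
  have growth: "norm (F t) < A' * exp (B' * cmod t powr k)" if t: "t \<in> T" for t
  proof -
    define X Y where "X = cmod t powr k" "Y = exp (k * \<beta> t)"
    have Y: "Y \<le> P + Q * X"
    proof -
      have "Y = (exp a + 2 * cmod t / r0) powr k" by (simp add: X_Y_def powr_def flip: exp_\<beta>)
      also have "\<dots> \<le> (2 * exp a) powr k + (2 * (2 * cmod t / r0)) powr k"
        using pos0 k by (intro powr_add_le) auto
      also have "2 * (2 * cmod t / r0) = (4 / r0) * cmod t" by simp
      also have "(\<dots>) powr k = Q * X" using pos0 by (subst powr_mult) (auto simp: E_E'_P_Q_def X_Y_def)
      finally show ?thesis by (simp add: E_E'_P_Q_def)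
    qed
    \<comment> \<open>The length of the contour is absorbed into the exponential by applying x <=
      exp x twice, first to k (\<beta> - a) and then to E Y.\<close>
    have len: "(\<beta> t - a) + 2 * pi \<le> (1 / k + 2 * pi) * exp (E * Y)"
    proof -
      have "k * (\<beta> t - a) \<le> exp (k * (\<beta> t - a))" using exp_ge_add_one_self[of "k * (\<beta> t - a)"] by linarith
      also have "\<dots> = E * Y" by (simp add: E_E'_P_Q_def X_Y_def algebra_simps flip: exp_add)
      also have "\<dots> \<le> exp (E * Y)" using exp_ge_add_one_self[of "E * Y"] by linarith
      finally have "\<beta> t - a \<le> 1 / k * exp (E * Y)" using k by (simp add: field_simps)
      moreover have "2 * pi * 1 \<le> 2 * pi * exp (E * Y)"
        by (intro mult_left_mono) (auto simp: E_E'_P_Q_def X_Y_def)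
      ultimately show ?thesis by (simp only: distrib_right)
    qed
    have "norm (F t) \<le> 5 * ((\<beta> t - a) + 2 * pi) * ((A * exp (B * Y)) * (Af * exp (Bf * (E' * X))))"
      unfolding F_def
    proof (rule norm_transform_le[OF \<beta>(1) t[unfolded T_def] \<beta>(2)])
      fix j \<zeta> assume j: "j < 5" "\<zeta> \<in> edge (\<beta> t) j"
      show "cmod (G \<zeta>) \<le> A * exp (B * Y)" using AB(3)[OF \<beta>(1) j] by (simp add: X_Y_def)
      have "norm (f (t * exp (- \<zeta>))) \<le> Af * exp (Bf * cmod (t * exp (- \<zeta>)) powr k)"
        using f_bound(3)[OF edge_maps[OF j(1) \<beta>(1) j(2) t[unfolded T_def] \<beta>(2)]] by simp
      also have "\<dots> \<le> Af * exp (Bf * (E' * X))"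
      proof -
        have "cmod (t * exp (- \<zeta>)) \<le> exp (- a) * cmod t"
          using edge_cases(1)[OF j(1) \<beta>(1) j(2)] by (simp add: norm_mult mult_mono mult.commute)
        then have "cmod (t * exp (- \<zeta>)) powr k \<le> (exp (- a) * cmod t) powr k" using k by (intro powr_mono2) auto
        also have "\<dots> = E' * X" by (simp add: powr_mult E_E'_P_Q_def X_Y_def)
        finally show ?thesis using f_bound by simp
      qed
      finally show "norm (f (t * exp (- \<zeta>))) \<le> Af * exp (Bf * (E' * X))" .
    qed
    also have "\<dots> \<le> 5 * ((1 / k + 2 * pi) * exp (E * Y)) * ((A * exp (B * Y)) * (Af * exp (Bf * (E' * X))))"
      using len AB f_bound by (intro mult_right_mono mult_left_mono) auto
    also have "\<dots> = K * exp ((E + B) * Y + Bf * E' * X)"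
    proof -
      have "exp ((E + B) * Y + Bf * E' * X) = exp (E * Y) * exp (B * Y) * exp (Bf * (E' * X))"
        by (simp add: distrib_right mult.assoc flip: exp_add)
      then show ?thesis unfolding K_def by (simp only: mult_ac)
    qed
    also have "\<dots> \<le> K * exp ((E + B) * (P + Q * X) + Bf * E' * X)"
    proof -
      have "(E + B) * Y \<le> (E + B) * (P + Q * X)"
        using Y AB by (intro mult_left_mono) (auto simp: E_E'_P_Q_def)
      then show ?thesis using K0 by (intro mult_left_mono) auto
    qed
    also have "\<dots> = K * exp ((E + B) * P) * exp (((E + B) * Q + Bf * E') * X)"
      by (simp add: algebra_simps flip: exp_add)
    also have "\<dots> \<le> K * exp ((E + B) * P) * exp (B' * X)"
      using K0 by (intro mult_left_mono) (auto simp: A'_B'_def X_Y_def distrib_right)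
    also have "\<dots> < A' * exp (B' * X)" by (simp add: A'_B'_def)
    finally show ?thesis by (simp add: X_Y_def)
  qed
  have "F \<in> exp_growth_functions k d (\<alpha>0 / 2) (r0 * exp a)"
    unfolding exp_growth_functions_def mem_Collect_eq
  proof (intro conjI ballI)
    show "F vholomorphic_on disc_sector d (\<alpha>0 / 2) (r0 * exp a)" using hol by (simp add: T_def)
    fix \<alpha>' r' assume "\<alpha>' \<in> {0<..<\<alpha>0 / 2}" "r' \<in> {0<..<r0 * exp a}"
    then have "disc_sector d \<alpha>' r' \<subseteq> T" unfolding T_def by (intro disc_sector_mono) auto
    then show "\<exists>A>0. \<exists>B>0. \<forall>t\<in>disc_sector d \<alpha>' r'. norm (F t) < A * exp (B * cmod t powr k)"
      using growth pos' by blast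
  qed
  moreover have "\<alpha>0 / 2 > 0" "r0 * exp a > 0" using pos0 by auto
  ultimately show ?thesis using sum by blast
qed

section \<open>The kernel of a sequence preserving q-Gevrey expansions\<close>

text \<open>The squared logarithm is negligible against every positive power, which bounds the
  quotient \<open>w\<close> near infinity; on the remaining compact interval it is continuous since
  h > 0.\<close>

lemma q_growth_le_exp_growth:
  fixes q h k C \<beta> :: real
  assumes "q > 1" "h > 0" "k > 0"
  obtains A where "\<And>X. X \<ge> 0 \<Longrightarrow> C * exp ((ln (X + h))\<^sup>2 / (2 * ln q)) * (X + h) powr \<beta> \<le> A * exp (X powr k)"
proof -
  define K where "K = 1 / (2 * ln q)"
  have K: "K > 0" using assms by (simp add: K_def)
  define w where "w X = exp (K * (ln (X + h))\<^sup>2 + \<beta> * ln (X + h) - X powr k)" for X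
  have "filterlim (\<lambda>X. K * (ln (X + h))\<^sup>2 + \<beta> * ln (X + h) - X powr k) at_bot at_top"
    using K assms by real_asymp
  then have "\<forall>\<^sub>F X in at_top. K * (ln (X + h))\<^sup>2 + \<beta> * ln (X + h) - X powr k \<le> 0"
    unfolding filterlim_at_bot by blast
  then obtain X0 where X0: "\<And>X. X \<ge> X0 \<Longrightarrow> w X \<le> 1"
    by (auto simp: w_def eventually_at_top_linorder)
  have "continuous_on {0..X0} w"
    unfolding w_def using assms by (intro continuous_intros continuous_on_powr') auto
  then have "compact (w ` {0..X0})" by (intro compact_continuous_image) auto
  then obtain M where M: "\<And>y. y \<in> w ` {0..X0} \<Longrightarrow> norm y \<le> M"
    using compact_imp_bounded bounded_pos by metis
  have w: "w X \<le> \<bar>M\<bar> + 1" if "X \<ge> 0" for X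
    using X0[of X] M[of "w X"] that by (cases "X \<ge> X0") auto
  show ?thesis
  proof
    fix X :: real assume X: "X \<ge> 0"
    have "exp ((ln (X + h))\<^sup>2 / (2 * ln q)) * (X + h) powr \<beta> = w X * exp (X powr k)"
      using X assms by (simp add: w_def powr_def K_def flip: exp_add)
    also have "\<dots> \<le> (\<bar>M\<bar> + 1) * exp (X powr k)" using w[OF X] by (intro mult_right_mono) auto
    finally have le: "exp ((ln (X + h))\<^sup>2 / (2 * ln q)) * (X + h) powr \<beta> \<le> (\<bar>M\<bar> + 1) * exp (X powr k)" .
    have "C * (exp ((ln (X + h))\<^sup>2 / (2 * ln q)) * (X + h) powr \<beta>)
        \<le> \<bar>C\<bar> * (exp ((ln (X + h))\<^sup>2 / (2 * ln q)) * (X + h) powr \<beta>)"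
      by (intro mult_right_mono) auto
    also have "\<dots> \<le> \<bar>C\<bar> * ((\<bar>M\<bar> + 1) * exp (X powr k))" using le by (intro mult_left_mono) auto
    finally show "C * exp ((ln (X + h))\<^sup>2 / (2 * ln q)) * (X + h) powr \<beta>
        \<le> (\<bar>C\<bar> * (\<bar>M\<bar> + 1)) * exp (X powr k)" by (simp add: mult.assoc)
  qed
qed

definition strip :: "real \<Rightarrow> real \<Rightarrow> complex set" where
  "strip \<theta> \<eta> = {\<zeta>. \<theta> - \<eta> < Im \<zeta>} \<inter> {\<zeta>. Im \<zeta> < \<theta> + \<eta>}"

lemma open_strip: "open (strip \<theta> \<eta>)" and convex_strip: "convex (strip \<theta> \<eta>)"
  unfolding strip_def
  by (intro open_Int convex_Int open_halfspace_Im_gt open_halfspace_Im_lt convex_halfspace_Im_gt convex_halfspace_Im_lt)+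

text \<open>S is stable under translation to the left, so it meets the half-plane of agreement, in
  applications the region where both functions are sums of the same series; the identity theorem
  then applies.\<close>

lemma holomorphic_eq_if_eq_on_left:
  assumes S: "open S" "convex S" "\<And>\<zeta> x. \<zeta> \<in> S \<Longrightarrow> x \<ge> 0 \<Longrightarrow> \<zeta> - of_real x \<in> S"
    and hol: "h holomorphic_on S" "g holomorphic_on S"
    and eq: "\<And>\<zeta>. \<zeta> \<in> S \<Longrightarrow> Re \<zeta> < y \<Longrightarrow> h \<zeta> = g \<zeta>" and \<zeta>: "\<zeta> \<in> S"
  shows "h \<zeta> = g \<zeta>"
proof (rule analytic_continuation_open[OF _ S(1) _ _ _ hol _ \<zeta>])
  let ?U = "S \<inter> {\<zeta>. Re \<zeta> < y}"
  show "open ?U" using S(1) by (intro open_Int open_halfspace_Re_lt)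
  have "\<zeta> - of_real (max 0 (Re \<zeta> - y + 1)) \<in> ?U" using S(3)[OF \<zeta>, of "max 0 (Re \<zeta> - y + 1)"] by auto
  then show "?U \<noteq> {}" by blast
  show "connected S" using S(2) by (rule convex_connected)
qed (use eq in auto)

text \<open>What a single direction contributes to \<open>summability_kernel\<close>, in the
  coordinate log t. Both \<eta> and y may vary with \<theta> without any control.\<close>

definition local_kernel :: "(nat \<Rightarrow> real) \<Rightarrow> real \<Rightarrow> real \<Rightarrow> (complex \<Rightarrow> complex) \<Rightarrow> real \<Rightarrow> bool" where
  "local_kernel c \<theta> \<eta> H y \<longleftrightarrow> \<eta> > 0 \<and> H holomorphic_on strip \<theta> \<eta> \<and>
     (\<forall>\<zeta>. Re \<zeta> < y \<longrightarrow> (\<lambda>n. of_real (c n) * exp \<zeta> ^ n) sums H \<zeta>) \<and>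
     (\<forall>k>0. \<exists>A. \<forall>\<zeta>\<in>strip \<theta> \<eta>. cmod (H \<zeta>) \<le> A * exp (exp (k * Re \<zeta>)))"

text \<open>A functional with \<phi> x distinct from 0, followed by division by \<phi> x, turns the
  vector series with coefficients c n x into the scalar one with coefficients c n.\<close>

lemma local_kernel_exists:
  fixes x :: "'e::complex_banach"
  assumes q: "q > 1" and x: "x \<noteq> 0"
    and ext: "q_extends_in_direction q 1 \<theta> (Abs_fps (\<lambda>n. c n *\<^sub>R x))"
  shows "\<exists>\<eta> H y. local_kernel c \<theta> \<eta> H y"
proof -
  obtain \<alpha> r F where F: "\<alpha> > 0" "r > 0" "F vholomorphic_on disc_sector \<theta> \<alpha> r"
    "has_sum_near_0 (Abs_fps (\<lambda>n. c n *\<^sub>R x)) F" "q_exp_growth q 1 F (sector \<theta> \<alpha>)"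
    using ext unfolding q_extends_in_direction_def by blast
  obtain \<rho> where \<rho>: "\<rho> > 0" "\<And>t. t \<in> ball 0 \<rho> \<Longrightarrow> (\<lambda>n. t ^ n *\<^sub>C c n *\<^sub>R x) sums F t"
    using F(4) by (auto simp: has_sum_near_0_def)
  obtain C h \<beta> where C: "h > 0"
    "\<And>t. t \<in> sector \<theta> \<alpha> \<Longrightarrow> norm (F t) \<le> C * exp ((ln (cmod t + h))\<^sup>2 / (2 * ln q)) * (cmod t + h) powr \<beta>"
    using F(5) unfolding q_exp_growth_def by auto
  obtain \<phi> where \<phi>: "\<phi> \<in> functionals" "norm x \<le> cmod (\<phi> x)" by (rule norming_functional)
  interpret bounded_linear \<phi> by (rule functionals_bounded_linear[OF \<phi>(1)])
  have \<phi>x: "\<phi> x \<noteq> 0" "cmod (\<phi> x) > 0" using \<phi>(2) x by auto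
  define H where "H \<zeta> = \<phi> (F (exp \<zeta>)) / \<phi> x" for \<zeta>
  have exp_strip: "exp \<zeta> \<in> sector \<theta> \<alpha>" if "\<zeta> \<in> strip \<theta> (\<alpha> / 2)" for \<zeta>
    using that unfolding sector_eq_exp_image strip_def by auto
  have "(\<lambda>t. \<phi> (F t)) \<circ> exp holomorphic_on strip \<theta> (\<alpha> / 2)"
    using exp_strip
    by (intro holomorphic_on_compose_gen[OF _ holomorphic_on_functional[OF F(3) \<phi>(1)]] holomorphic_intros)
      (auto simp: disc_sector_def)
  then have "H holomorphic_on strip \<theta> (\<alpha> / 2)"
    unfolding H_def using \<phi>x by (intro holomorphic_intros) (auto simp: o_def)
  moreover have "(\<lambda>n. of_real (c n) * exp \<zeta> ^ n) sums H \<zeta>" if "Re \<zeta> < ln \<rho>" for \<zeta>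
  proof -
    have "exp \<zeta> \<in> ball 0 \<rho>" using that \<rho>(1) exp_less_mono[OF that] by simp
    from functional_sums[OF \<phi>(1) \<rho>(2)[OF this]]
    have "(\<lambda>n. \<phi> (c n *\<^sub>R x) * exp \<zeta> ^ n / \<phi> x) sums H \<zeta>" unfolding H_def by (rule sums_divide)
    then show ?thesis using \<phi>x by (simp add: scaleR scaleR_conv_of_real)
  qed
  moreover have "\<exists>A. \<forall>\<zeta>\<in>strip \<theta> (\<alpha> / 2). cmod (H \<zeta>) \<le> A * exp (exp (k * Re \<zeta>))" if k: "k > 0" for k
  proof -
    obtain A where A: "\<And>X. X \<ge> 0 \<Longrightarrow>
        C * exp ((ln (X + h))\<^sup>2 / (2 * ln q)) * (X + h) powr \<beta> \<le> A * exp (X powr k)"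
      using q_growth_le_exp_growth[OF q C(1) k] by metis
    have "cmod (H \<zeta>) \<le> 2 * A / cmod (\<phi> x) * exp (exp (k * Re \<zeta>))" if "\<zeta> \<in> strip \<theta> (\<alpha> / 2)" for \<zeta>
    proof -
      have "cmod (\<phi> (F (exp \<zeta>))) \<le> 2 * norm (F (exp \<zeta>))" by (rule functionals_bound[OF \<phi>(1)])
      also have "norm (F (exp \<zeta>)) \<le> A * exp (exp (Re \<zeta>) powr k)"
        using order_trans[OF C(2)[OF exp_strip[OF that]] A[OF norm_ge_zero]] by simp
      also have "exp (Re \<zeta>) powr k = exp (k * Re \<zeta>)" by (simp add: powr_def)
      finally show ?thesis using \<phi>x by (simp add: H_def norm_divide divide_right_mono mult.assoc)
    qed
    then show ?thesis by blast
  qed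
  ultimately have "local_kernel c \<theta> (\<alpha> / 2) H (ln \<rho>)"
    using F(1) by (auto simp: local_kernel_def)
  then show ?thesis by blast
qed

text \<open>Gluing: outside the half-plane, G uses at each point the extension for the direction Im
  \<zeta>. Overlapping strips reach arbitrarily far left, where both extensions are the same series,
  so the choice is immaterial and G is holomorphic.\<close>

lemma summability_kernel_exists:
  assumes "\<And>\<theta>. 0 < \<theta> \<Longrightarrow> \<theta> < 2 * pi \<Longrightarrow> \<exists>\<eta> H y. local_kernel c \<theta> \<eta> H y"
  shows "\<exists>G x0. summability_kernel c G x0"
proof -
  let ?I = "{0<..<2 * pi}"
  have "\<forall>\<theta>\<in>?I. \<exists>\<eta> H y. local_kernel c \<theta> \<eta> H y" using assms by auto
  then obtain \<eta> H y where lk: "\<And>\<theta>. \<theta> \<in> ?I \<Longrightarrow> local_kernel c \<theta> (\<eta> \<theta>) (H \<theta>) (y \<theta>)" by metis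
  have \<eta>: "\<eta> \<theta> > 0" and H_hol: "H \<theta> holomorphic_on strip \<theta> (\<eta> \<theta>)"
    and H_sums: "\<And>\<zeta>. Re \<zeta> < y \<theta> \<Longrightarrow> (\<lambda>n. of_real (c n) * exp \<zeta> ^ n) sums H \<theta> \<zeta>"
    and H_growth: "\<And>k. k > 0 \<Longrightarrow> \<exists>A. \<forall>\<zeta>\<in>strip \<theta> (\<eta> \<theta>). cmod (H \<theta> \<zeta>) \<le> A * exp (exp (k * Re \<zeta>))"
    if "\<theta> \<in> ?I" for \<theta>
    using lk[OF that] by (auto simp: local_kernel_def)
  \<comment> \<open>The series is the same for all directions, so any one of them provides a
    half-plane of convergence; \<open>pi\<close> is an arbitrary choice.\<close>
  define x0 where "x0 = y pi"
  have pi: "pi \<in> ?I" by simp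
  define P where "P w = (\<Sum>n. of_real (c n) * w ^ n)" for w :: complex
  define G where "G \<zeta> = (if Re \<zeta> < x0 then P (exp \<zeta>) else H (Im \<zeta>) \<zeta>)" for \<zeta>
  have P_sums: "(\<lambda>n. of_real (c n) * exp \<zeta> ^ n) sums P (exp \<zeta>)" if "Re \<zeta> < x0" for \<zeta>
    using H_sums[OF pi, of \<zeta>] that by (auto simp: P_def x0_def sums_iff)
  have "P holomorphic_on ball 0 (exp x0) - {0}"
  proof (rule holomorphic_on_subset[OF power_series_holomorphic])
    fix w :: complex assume w: "w \<in> ball 0 (exp x0)"
    show "(\<lambda>n. of_real (c n) * (w - 0) ^ n) sums P w"
    proof (cases "w = 0")
      case True
      then show ?thesis using powser_sums_zero[of "\<lambda>n. complex_of_real (c n)"]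
        by (simp add: P_def)
    next
      case False
      then have "ln (cmod w) < ln (exp x0)" using w by (subst ln_less_cancel_iff) auto
      then show ?thesis using False P_sums[of "Ln w"] by simp
    qed
  qed auto
  then have "P \<circ> exp holomorphic_on {\<zeta>. Re \<zeta> < x0}"
    by (rule holomorphic_on_compose_gen[rotated]) (auto intro: holomorphic_intros)
  then have P_hol: "(\<lambda>\<zeta>. P (exp \<zeta>)) holomorphic_on {\<zeta>. Re \<zeta> < x0}" by (simp add: o_def)
  have G_eq: "G \<zeta> = H \<theta> \<zeta>" if \<theta>: "\<theta> \<in> ?I" and \<zeta>: "\<zeta> \<in> strip \<theta> (\<eta> \<theta>)" "Im \<zeta> \<in> ?I" for \<theta> \<zeta>
  proof (cases "Re \<zeta> < x0")
    case True
    let ?S = "strip \<theta> (\<eta> \<theta>) \<inter> {\<zeta>. Re \<zeta> < x0}"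
    have "P (exp \<zeta>) = H \<theta> \<zeta>"
    proof (rule holomorphic_eq_if_eq_on_left[where S = ?S and y = "y \<theta>" and h = "\<lambda>\<zeta>. P (exp \<zeta>)" and g = "H \<theta>"])
      show "open ?S" "convex ?S"
        by (intro open_Int convex_Int open_strip convex_strip open_halfspace_Re_lt convex_halfspace_Re_lt)+
      show "z - of_real x \<in> ?S" if "z \<in> ?S" "x \<ge> 0" for z x using that by (auto simp: strip_def)
      show "(\<lambda>\<zeta>. P (exp \<zeta>)) holomorphic_on ?S" using P_hol by (rule holomorphic_on_subset) auto
      show "H \<theta> holomorphic_on ?S" using H_hol[OF \<theta>] by (rule holomorphic_on_subset) auto
      show "P (exp z) = H \<theta> z" if "z \<in> ?S" "Re z < y \<theta>" for z
        using that P_sums H_sums[OF \<theta>] sums_unique2 by blast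
    qed (use True \<zeta> in auto)
    then show ?thesis using True by (simp add: G_def)
  next
    case False
    let ?\<tau> = "Im \<zeta>"
    let ?S = "strip \<theta> (\<eta> \<theta>) \<inter> strip ?\<tau> (\<eta> ?\<tau>)"
    have "H ?\<tau> \<zeta> = H \<theta> \<zeta>"
    proof (rule holomorphic_eq_if_eq_on_left[where S = ?S and h = "H ?\<tau>" and g = "H \<theta>" and y = "min (y \<theta>) (y ?\<tau>)"])
      show "open ?S" "convex ?S" by (intro open_Int convex_Int open_strip convex_strip)+
      show "z - of_real x \<in> ?S" if "z \<in> ?S" "x \<ge> 0" for z x
        using that by (auto simp: strip_def)
      show "H ?\<tau> holomorphic_on ?S" using H_hol[OF \<zeta>(2)] by (rule holomorphic_on_subset) auto
      show "H \<theta> holomorphic_on ?S" using H_hol[OF \<theta>] by (rule holomorphic_on_subset) auto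
      show "H ?\<tau> z = H \<theta> z" if "z \<in> ?S" "Re z < min (y \<theta>) (y ?\<tau>)" for z
        using that H_sums[OF \<zeta>(2), of z] H_sums[OF \<theta>, of z] sums_unique2 by auto
      show "\<zeta> \<in> ?S" using \<zeta>(1) \<eta>[OF \<zeta>(2)] by (simp add: strip_def)
    qed
    then show ?thesis using False by (simp add: G_def)
  qed
  have "summability_kernel c G x0"
    unfolding summability_kernel_def
  proof (intro conjI allI impI)
    let ?T = "\<lambda>\<theta>. strip \<theta> (\<eta> \<theta>) \<inter> ({\<zeta>. 0 < Im \<zeta>} \<inter> {\<zeta>. Im \<zeta> < 2 * pi})"
    have oT: "open (?T \<theta>)" for \<theta>
      by (intro open_Int open_strip open_halfspace_Im_gt open_halfspace_Im_lt)
    have "G holomorphic_on (\<Union>\<theta>\<in>?I. ?T \<theta>)"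
    proof (rule holomorphic_on_UN_open[OF _ oT])
      fix \<theta> assume \<theta>: "\<theta> \<in> ?I"
      have "H \<theta> holomorphic_on ?T \<theta>" using H_hol[OF \<theta>] by (rule holomorphic_on_subset) auto
      then show "G holomorphic_on ?T \<theta>"
        by (rule holomorphic_transform) (use G_eq[OF \<theta>] in auto)
    qed
    moreover have "{\<zeta>. 0 < Im \<zeta> \<and> Im \<zeta> < 2 * pi} \<subseteq> (\<Union>\<theta>\<in>?I. ?T \<theta>)"
    proof
      fix \<zeta> assume "\<zeta> \<in> {\<zeta>. 0 < Im \<zeta> \<and> Im \<zeta> < 2 * pi}"
      then show "\<zeta> \<in> (\<Union>\<theta>\<in>?I. ?T \<theta>)" using \<eta>[of "Im \<zeta>"]
        by (intro UN_I[of "Im \<zeta>"]) (auto simp: strip_def)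
    qed
    moreover have "G holomorphic_on {\<zeta>. Re \<zeta> < x0}"
      using P_hol by (rule holomorphic_transform) (simp add: G_def)
    ultimately have "G holomorphic_on ((\<Union>\<theta>\<in>?I. ?T \<theta>) \<union> {\<zeta>. Re \<zeta> < x0})"
      using oT by (intro holomorphic_on_Un open_UN open_halfspace_Re_lt) auto
    then show "G holomorphic_on ({\<zeta>. 0 < Im \<zeta> \<and> Im \<zeta> < 2 * pi} \<union> {\<zeta>. Re \<zeta> < x0})"
      using \<open>_ \<subseteq> (\<Union>\<theta>\<in>?I. ?T \<theta>)\<close> by (elim holomorphic_on_subset) blast
    show "(\<lambda>n. of_real (c n) * exp \<zeta> ^ n) sums G \<zeta>" if "Re \<zeta> < x0" for \<zeta>
      using P_sums[OF that] that by (simp add: G_def)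
    fix k \<epsilon> :: real assume k: "k > 0" and \<epsilon>: "\<epsilon> > 0"
    obtain A where A: "\<And>\<theta> \<zeta>. \<theta> \<in> ?I \<Longrightarrow> \<zeta> \<in> strip \<theta> (\<eta> \<theta>) \<Longrightarrow> cmod (H \<theta> \<zeta>) \<le> A \<theta> * exp (exp (k * Re \<zeta>))"
      using H_growth[OF _ k] by metis
    \<comment> \<open>Finitely many strips cover the compact range of arguments, which makes the
      growth constant uniform although openings and constants vary with the direction.\<close>
    obtain D where D: "D \<subseteq> ?I" "finite D" "{\<epsilon>..2 * pi - \<epsilon>} \<subseteq> (\<Union>\<theta>\<in>D. {\<theta> - \<eta> \<theta><..<\<theta> + \<eta> \<theta>})"
    proof (rule compactE_image[of "{\<epsilon>..2 * pi - \<epsilon>}" ?I "\<lambda>\<theta>. {\<theta> - \<eta> \<theta><..<\<theta> + \<eta> \<theta>}"])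
      show "{\<epsilon>..2 * pi - \<epsilon>} \<subseteq> (\<Union>\<theta>\<in>?I. {\<theta> - \<eta> \<theta><..<\<theta> + \<eta> \<theta>})"
      proof
        fix \<theta> assume "\<theta> \<in> {\<epsilon>..2 * pi - \<epsilon>}"
        then show "\<theta> \<in> (\<Union>\<theta>\<in>?I. {\<theta> - \<eta> \<theta><..<\<theta> + \<eta> \<theta>})"
          using \<epsilon> \<eta>[of \<theta>] by (intro UN_I[of \<theta>]) auto
      qed
    qed auto
    show "\<exists>A B. \<forall>\<zeta>. \<epsilon> \<le> Im \<zeta> \<and> Im \<zeta> \<le> 2 * pi - \<epsilon> \<longrightarrow> cmod (G \<zeta>) \<le> A * exp (B * exp (k * Re \<zeta>))"
    proof (rule exI[of _ "\<Sum>\<theta>\<in>D. \<bar>A \<theta>\<bar>"], rule exI[of _ 1], intro allI impI)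
      fix \<zeta> assume \<zeta>: "\<epsilon> \<le> Im \<zeta> \<and> Im \<zeta> \<le> 2 * pi - \<epsilon>"
      then obtain \<theta> where \<theta>: "\<theta> \<in> D" "\<zeta> \<in> strip \<theta> (\<eta> \<theta>)"
        using D(3) by (fastforce simp: strip_def)
      have "cmod (G \<zeta>) \<le> A \<theta> * exp (exp (k * Re \<zeta>))"
        using G_eq[of \<theta> \<zeta>] A[of \<theta> \<zeta>] \<theta> D(1) \<zeta> \<epsilon> by auto
      also have "A \<theta> \<le> (\<Sum>\<theta>\<in>D. \<bar>A \<theta>\<bar>)"
        using member_le_sum[OF \<theta>(1) _ D(2), of "\<lambda>\<theta>. \<bar>A \<theta>\<bar>"] by auto
      finally show "cmod (G \<zeta>) \<le> (\<Sum>\<theta>\<in>D. \<bar>A \<theta>\<bar>) * exp (1 * exp (k * Re \<zeta>))" by simp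
    qed
  qed
  then show ?thesis by blast
qed

section \<open>The inclusion and its strictness\<close>

lemma summable_in_direction_hadamard:
  fixes u v :: "'e::complex_banach fps"
  assumes "summability_kernel c G x0" "k > 0" and v: "\<And>n. fps_nth v n = c n *\<^sub>R fps_nth u n"
    and u: "summable_in_direction k d u"
  shows "summable_in_direction k d v"
proof -
  let ?B = "borel_map (\<lambda>n. Gamma (1 + real n / k))"
  have "fps_nth (?B v) n = c n *\<^sub>R fps_nth (?B u) n" for n
    by (simp add: borel_map_def v mult.commute)
  then show ?thesis
    using u exp_growth_functions_hadamard[OF assms(1,2), of _ _ _ d "?B u" "?B v"]
    unfolding summable_in_direction_def by blast
qed

text \<open>The kernel with coefficients 1 / m n serves the forward implication, the one with
  coefficients m n the converse.\<close>

theorem preserves_summability_if_kernels: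
  assumes m: "\<And>n. m n > 0"
    and "summability_kernel (\<lambda>n. 1 / m n) G x0" "summability_kernel m H y0"
  shows "preserves_summability TYPE('e::complex_banach) m"
  unfolding preserves_summability_def
proof (intro allI impI iffI)
  fix k d :: real and u :: "'e fps" assume k: "k > 0"
  have m0: "m n \<noteq> 0" for n using m[of n] by simp
  show "summable_in_direction k d (borel_map m u)" if "summable_in_direction k d u"
    by (rule summable_in_direction_hadamard[OF assms(2) k _ that]) (simp add: borel_map_def inverse_eq_divide)
  show "summable_in_direction k d u" if "summable_in_direction k d (borel_map m u)"
    by (rule summable_in_direction_hadamard[OF assms(3) k _ that]) (simp add: borel_map_def m0)
qed

text \<open>Frees the q-Gevrey condition from its weights: every coefficient sequence occurs as a
  q-Borel transform, and dividing by m n commutes with the weights.\<close>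

lemma q_borel_map_surj:
  assumes "q > 1"
  obtains u :: "'e::complex_banach fps" where "q_borel_map q s u = Abs_fps a"
    "q_borel_map q s (borel_map m u) = Abs_fps (\<lambda>n. a n /\<^sub>R m n)"
proof
  let ?Q = "\<lambda>n. q powr (s * real n * (real n - 1) / 2)"
  let ?u = "Abs_fps (\<lambda>n. ?Q n *\<^sub>R a n)"
  have Q: "?Q n \<noteq> 0" for n using assms by simp
  show "q_borel_map q s ?u = Abs_fps a"
    using Q by (simp add: q_borel_map_def borel_map_def)
  show "q_borel_map q s (borel_map m ?u) = Abs_fps (\<lambda>n. a n /\<^sub>R m n)"
    using Q by (simp add: q_borel_map_def borel_map_def mult.left_commute)
qed

text \<open>The constant sequence x is mapped to x / m n, which yields the first kernel. The
  sequence m n x is mapped to the constant one, so the equivalence read backwards yields the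
  second.\<close>

lemma preserves_q_Gevrey_imp_preserves_summability:
  fixes x :: "'e::complex_banach"
  assumes q: "q > 1" and x: "x \<noteq> 0" and m: "\<And>n. m n > 0"
    and pres: "preserves_q_Gevrey TYPE('e) q m"
  shows "preserves_summability TYPE('e) m"
proof -
  have m0: "m n \<noteq> 0" for n using m[of n] by simp
  have iff: "q_extends_in_direction q 1 d (Abs_fps a) \<longleftrightarrow>
      q_extends_in_direction q 1 d (Abs_fps (\<lambda>n. a n /\<^sub>R m n))" for d and a :: "nat \<Rightarrow> 'e"
    using q_borel_map_surj[OF q, of 1 a m] pres unfolding preserves_q_Gevrey_def
    by (metis zero_less_one)
  have geom: "q_extends_in_direction q 1 \<theta> (Abs_fps (\<lambda>n. x))" if "0 < \<theta>" "\<theta> < 2 * pi" for \<theta>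
    by (rule q_extends_in_direction_geometric[OF q zero_less_one that])
  have "\<exists>\<eta> H y. local_kernel (\<lambda>n. 1 / m n) \<theta> \<eta> H y" if "0 < \<theta>" "\<theta> < 2 * pi" for \<theta>
    by (rule local_kernel_exists[OF q x]) (use geom[OF that] iff[of \<theta> "\<lambda>n. x"] in \<open>simp add: inverse_eq_divide\<close>)
  then obtain G x0 where G: "summability_kernel (\<lambda>n. 1 / m n) G x0"
    using summability_kernel_exists by blast
  have "\<exists>\<eta> H y. local_kernel m \<theta> \<eta> H y" if "0 < \<theta>" "\<theta> < 2 * pi" for \<theta>
    by (rule local_kernel_exists[OF q x]) (use geom[OF that] iff[of \<theta> "\<lambda>n. m n *\<^sub>R x"] m0 in simp)
  then obtain H y0 where H: "summability_kernel m H y0"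
    using summability_kernel_exists by blast
  show ?thesis by (rule preserves_summability_if_kernels[OF m G H])
qed

lemma ex_preserves_summability_not_q_Gevrey:
  fixes x :: "'e::complex_banach"
  assumes q: "q > 1" and x: "x \<noteq> 0"
  shows "\<exists>m\<in>admissible_sequences. preserves_summability TYPE('e) m \<and> \<not> preserves_q_Gevrey TYPE('e) q m"
proof -
  \<comment> \<open>At n = 0 the formula alone would give e 0 = 1 and m 0 = 1/2; the separate value
    0 secures m 0 = 1.\<close>
  define e :: "nat \<Rightarrow> real" where "e = (\<lambda>n. if n = 0 then 0 else (-1) ^ n * exp (- (real n powr (3/2))))"
  define m where "m n = 1 / (1 + e n)" for n
  have e: "\<bar>e n\<bar> \<le> exp (- (real n powr (3/2)))" for n by (simp add: e_def abs_mult)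
  have "\<bar>e n\<bar> < 1" for n by (simp add: e_def abs_mult)
  then have pos: "1 + e n > 0" for n using abs_less_iff[of "e n" 1] by (smt (verit))
  have "m \<in> admissible_sequences" using pos by (simp add: admissible_sequences_def m_def e_def)
  moreover have "preserves_summability TYPE('e) m"
    unfolding m_def[abs_def] by (rule preserves_summability_perturbation[OF e]) (simp add: e_def)
  moreover have "\<not> preserves_q_Gevrey TYPE('e) q m"
  proof
    assume pres: "preserves_q_Gevrey TYPE('e) q m"
    obtain u :: "'e fps" where u: "q_borel_map q 1 u = Abs_fps (\<lambda>n. x)"
      "q_borel_map q 1 (borel_map m u) = Abs_fps (\<lambda>n. x /\<^sub>R m n)"
      using q_borel_map_surj[OF q] by blast
    have "q_extends_in_direction q 1 pi (q_borel_map q 1 u)"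
      unfolding u by (rule q_extends_in_direction_geometric) (use q in auto)
    with pres have "q_extends_in_direction q 1 pi (q_borel_map q 1 (borel_map m u))"
      unfolding preserves_q_Gevrey_def by (meson zero_less_one)
    then show False
      using not_q_extends_in_direction_perturbation[OF q x e_def] by (simp add: u m_def)
  qed
  ultimately show ?thesis by blast
qed

theorem theorem7:
  fixes q :: real
  assumes "q > 1" and "(UNIV :: 'e::complex_banach set) \<noteq> {0}"
  shows "{m \<in> admissible_sequences. preserves_q_Gevrey TYPE('e) q m}
       \<subset> {m \<in> admissible_sequences. preserves_summability TYPE('e) m}"
proof -
  obtain x :: 'e where x: "x \<noteq> 0" using assms(2) by blast
  have "preserves_summability TYPE('e) m" if "m \<in> admissible_sequences" "preserves_q_Gevrey TYPE('e) q m" for m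
    using preserves_q_Gevrey_imp_preserves_summability[OF assms(1) x _ that(2)] that(1)
    by (simp add: admissible_sequences_def)
  then show ?thesis using ex_preserves_summability_not_q_Gevrey[OF assms(1) x] by blast
qed

end
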